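(* Let $X_t$ be any process in $\mathbb{R}^d$ with additive components, with associated functions $y_t(r)$ and $\dot y_t(r)$ (see context). Fix $b\in(0,\infty)$ and let $\delta,\beta$ and the functions $\overline v,\underline v,\overline u,\underline u$ be as defined in the context. Any of the three conditions below implies that $\overline v\le\underline v$ and $\overline u\le\underline u$ (here $c_1,c_2,c$ are continuous slow functions): (i) $\dfrac{y_s(r_2)}{y_b(r_2)}\le c_1(r_1)^{-1}c_2(r_2)^{-1}\dfrac{y_s(r_1)}{y_b(r_1)}$ for all $r_1<r_2$ small and $s\in(0,b)$. (ii) $\dfrac{y_s(r)}{\dot y_s(r)}-\dfrac{y_b(r)}{\dot y_b(r)}\le\dfrac{\log c(r)}{\log r}$ for all small $r$ and $s\in(0,b)$. (iii) For some continuous function $v>0$ with values $v(s_n)=\inf\{s>0:\dot y_s(s_n^{1/\delta})\ge c(s_n)s_n\dot y_b(s_n^{1/\delta})\}$ at a sequence $s_n\downarrow0$, the function $$\overline f(t,\eta)=\Big[\frac{\dot y_{v(t)}(t^{1/\eta})}{c(t)\,t\,\dot y_b(t^{1/\eta})}\Big]\wedge1,\qquad t>0,\ \eta>0,$$ is uniformly continuous on $(0,t^*]\times[\delta-\varepsilon,\delta]$, and the function $$\underline f(t,\eta)=\Big[\frac{c(t)\,t\,\dot y_b(t^{1/\eta})}{\dot y_{v(t)}(t^{1/\eta})}\Big]\wedge1$$ is uniformly continuous on $(0,t^*]\times[\delta,\delta+\varepsilon]$, where $t^*>0$ is a constant. (This is the condition for $\overline v\le\underline v$; the similar condition, with $\beta$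 in place of $\delta$, is the one for $\overline u\le\underline u$.)
   Context: Put $\delta=\inf\{\eta\ge0:\liminf_{r\to0}r^\eta y_b(r)=0\}$ and $\beta=\inf\{\eta\ge0:\lim_{r\to0}r^\eta y_b(r)=0\}$. For small $t$, $\overline v(t)=\inf\{s>0:y_s(t^{1/\eta})\ge c(t)\,t\,y_b(t^{1/\eta})$ for all $\eta\in[\delta-\varepsilon,\delta)\}$, $\underline v(t)=\sup\{s>0:y_s(t^{1/\eta})\le c(t)^{-1}t\,y_b(t^{1/\eta})$ for all $\eta\in(\delta,\delta+\varepsilon]\}$, $\overline u(t)=\inf\{s>0:y_s(t^{1/\eta})\ge c(t)\,t\,y_b(t^{1/\eta})$ for all $\eta\in[\beta-\varepsilon,\beta)\}$, $\underline u(t)=\sup\{s>0:y_s(t^{1/\eta})\le c(t)^{-1}t\,y_b(t^{1/\eta})$ for all $\eta\in(\beta,\beta+\varepsilon]\}$, where $\varepsilon$ is a small positive constant and $c(t)$ is a continuous slow function. Slow function: a function $c:(0,1)\to(0,1)$ with $\liminf_{r\to0}c(r)r^{-\eta}>0$ for all $\eta>0$. Additive process: a process with independent increments, right-continuous paths with left limits, continuous in probability, with $X_0=0$. A process $X_t=(X_t^{(1)},\dots,X_t^{(d)})$ in $\mathbb{R}^d$ has additive components if each $X_t^{(i)}$ is a real additive process (the vector process itself need not have independent increments). A real additive process has characteristics $(B_t,C_t,\nu_t)$: $E e^{i\lambda X_t}=\exp\{i\lambda B_t-\tfrac12\lambda^2C_t+\int(e^{i\lambda x}-1-i\lambda x1(|x|\le1))\nu_t(dx)\}$,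 with $B_t$ continuous, $B_0=0$, $C_t$ nondecreasing continuous, $C_0=0$, $\nu_t$ a Lévy measure for each $t$, nondecreasing and continuous in $t$, $\nu_0=0$. For such a process put, for $r>0,t\ge0$, $$G_t(r)=\int_{|x|>r}\nu_t(dx),\quad K_t(r)=r^{-2}\Big[C_t+\int_{|x|\le r}x^2\nu_t(dx)\Big],$$ $$M_t(r)=r^{-1}\Big|B_t+\int_{1<|x|\le r\vee1}x\,\nu_t(dx)-\int_{r\wedge1<|x|\le1}x\,\nu_t(dx)\Big|,\quad M_t^*(r)=\max_{0\le s\le t}M_s(r),$$ and $y_t(r)=G_t(r)+K_t(r)+M_t^*(r)$. For a process in $\mathbb{R}^d$ with additive components, $y_t(r)=\sum_{i=1}^dy_t^{(i)}(r)$, where $y_t^{(i)}(r)$ is this function for $X_t^{(i)}$. Finally $$\dot y_t(r)=\Big(r^{-1}\int_0^ry_t(x)^{-1}dx\Big)^{-1},\qquad t>0,\ r>0.$$ *)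

theory Defs
  imports "HOL-Probability.Probability"
begin

section \<open>Additive processes and their characteristics\<close>

text \<open>Time is the half line \<open>{0..}\<close>; values at negative times are irrelevant throughout.\<close>

definition additive_process :: "'a measure \<Rightarrow> (real \<Rightarrow> 'a \<Rightarrow> real) \<Rightarrow> bool" where
  "additive_process M X \<longleftrightarrow>
     prob_space M \<and>
     (\<forall>t\<ge>0. X t \<in> borel_measurable M) \<and>
     (\<forall>\<omega>\<in>space M. X 0 \<omega> = 0) \<and>
     (\<forall>n \<tau>. 0 \<le> \<tau> 0 \<and> (\<forall>k<n. \<tau> k < \<tau> (Suc k)) \<longrightarrow>
        prob_space.indep_vars M (\<lambda>_. borel) (\<lambda>k \<omega>. X (\<tau> (Suc k)) \<omega> - X (\<tau> k) \<omega>) {..<n::nat}) \<and>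
     (\<forall>\<omega>\<in>space M.
        (\<forall>t\<ge>0. ((\<lambda>s. X s \<omega>) \<longlongrightarrow> X t \<omega>) (at_right t)) \<and>
        (\<forall>t>0. \<exists>l. ((\<lambda>s. X s \<omega>) \<longlongrightarrow> l) (at_left t))) \<and>
     (\<forall>t\<ge>0. \<forall>e>0.
        ((\<lambda>s. measure M {\<omega>\<in>space M. e < \<bar>X s \<omega> - X t \<omega>\<bar>}) \<longlongrightarrow> 0) (at t within {0..}))"

definition levy_measure :: "real measure \<Rightarrow> bool" where
  "levy_measure \<mu> \<longleftrightarrow>
     sets \<mu> = sets borel \<and> emeasure \<mu> {0} = 0 \<and>
     (\<integral>\<^sup>+ x. ennreal (min 1 (x\<^sup>2)) \<partial>\<mu>) < \<infinity>"

text \<open>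
  Continuity of \<open>\<nu>\<close> in time is the usual one for additive processes: continuity of
  \<open>\<nu> t A\<close> in \<open>t\<close> for every Borel set \<open>A\<close> bounded away from the origin.
\<close>

definition has_characteristics ::
  "'a measure \<Rightarrow> (real \<Rightarrow> 'a \<Rightarrow> real) \<Rightarrow> (real \<Rightarrow> real) \<Rightarrow> (real \<Rightarrow> real) \<Rightarrow> (real \<Rightarrow> real measure) \<Rightarrow> bool"
  where
  "has_characteristics M X B C \<nu> \<longleftrightarrow>
     continuous_on {0..} B \<and> B 0 = 0 \<and>
     continuous_on {0..} C \<and> mono_on {0..} C \<and> C 0 = 0 \<and>
     (\<forall>t\<ge>0. levy_measure (\<nu> t)) \<and>
     (\<forall>A\<in>sets borel. \<forall>s t. 0 \<le> s \<and> s \<le> t \<longrightarrow> emeasure (\<nu> s) A \<le> emeasure (\<nu> t) A) \<and>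
     (\<forall>A\<in>sets borel. (\<exists>r>0. \<forall>x\<in>A. r < \<bar>x\<bar>) \<longrightarrow> continuous_on {0..} (\<lambda>t. measure (\<nu> t) A)) \<and>
     (\<forall>A\<in>sets borel. emeasure (\<nu> 0) A = 0) \<and>
     (\<forall>t\<ge>0. \<forall>u. char (distr M borel (X t)) u =
        exp (\<i> * of_real (u * B t) - of_real (u\<^sup>2 * C t / 2) +
          (CLINT x|\<nu> t. iexp (u * x) - 1 - \<i> * of_real (u * x * indicator {-1..1} x))))"

section \<open>The functions \<open>y\<close> and \<open>ydot\<close>\<close>

definition G_fun :: "(real \<Rightarrow> real measure) \<Rightarrow> real \<Rightarrow> real \<Rightarrow> real" where
  "G_fun \<nu> t r = measure (\<nu> t) {x. r < \<bar>x\<bar>}"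

definition K_fun :: "(real \<Rightarrow> real) \<Rightarrow> (real \<Rightarrow> real measure) \<Rightarrow> real \<Rightarrow> real \<Rightarrow> real" where
  "K_fun C \<nu> t r = (C t + (LINT x:{x. \<bar>x\<bar> \<le> r}|\<nu> t. x\<^sup>2)) / r\<^sup>2"

definition M_fun :: "(real \<Rightarrow> real) \<Rightarrow> (real \<Rightarrow> real measure) \<Rightarrow> real \<Rightarrow> real \<Rightarrow> real" where
  "M_fun B \<nu> t r =
     \<bar>B t + (LINT x:{x. 1 < \<bar>x\<bar> \<and> \<bar>x\<bar> \<le> max r 1}|\<nu> t. x)
          - (LINT x:{x. min r 1 < \<bar>x\<bar> \<and> \<bar>x\<bar> \<le> 1}|\<nu> t. x)\<bar> / r"

definition Mstar_fun :: "(real \<Rightarrow> real) \<Rightarrow> (real \<Rightarrow> real measure) \<Rightarrow> real \<Rightarrow> real \<Rightarrow> real" where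
  "Mstar_fun B \<nu> t r = (SUP s\<in>{0..t}. M_fun B \<nu> s r)"

definition y_comp ::
  "(real \<Rightarrow> real) \<Rightarrow> (real \<Rightarrow> real) \<Rightarrow> (real \<Rightarrow> real measure) \<Rightarrow> real \<Rightarrow> real \<Rightarrow> real" where
  "y_comp B C \<nu> t r = G_fun \<nu> t r + K_fun C \<nu> t r + Mstar_fun B \<nu> t r"

definition y_fun ::
  "('d::finite \<Rightarrow> real \<Rightarrow> real) \<Rightarrow> ('d \<Rightarrow> real \<Rightarrow> real) \<Rightarrow> ('d \<Rightarrow> real \<Rightarrow> real measure) \<Rightarrow>
   real \<Rightarrow> real \<Rightarrow> real" where
  "y_fun B C \<nu> t r = (\<Sum>i\<in>UNIV. y_comp (B i) (C i) (\<nu> i) t r)"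

text \<open>
  If \<open>y t\<close> vanishes at one \<open>r > 0\<close> then it vanishes at all of them; the value of \<open>ydot\<close> is then
  \<open>0\<close>, in agreement with the convention \<open>1/0 = \<infinity>\<close>, \<open>1/\<infinity> = 0\<close>.
\<close>

definition ydot :: "(real \<Rightarrow> real \<Rightarrow> real) \<Rightarrow> real \<Rightarrow> real \<Rightarrow> real" where
  "ydot y t r = inverse ((LINT x:{0<..r}|lborel. inverse (y t x)) / r)"

section \<open>Indices, slow functions and the four time changes\<close>

definition delta_index :: "(real \<Rightarrow> real \<Rightarrow> real) \<Rightarrow> real \<Rightarrow> real" where
  "delta_index y b =
     Inf {\<eta>. 0 \<le> \<eta> \<and> Liminf (at_right 0) (\<lambda>r. ereal (r powr \<eta> * y b r)) = 0}"

definition beta_index :: "(real \<Rightarrow> real \<Rightarrow> real) \<Rightarrow> real \<Rightarrow> real" where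
  "beta_index y b = Inf {\<eta>. 0 \<le> \<eta> \<and> ((\<lambda>r. r powr \<eta> * y b r) \<longlongrightarrow> 0) (at_right 0)}"

definition continuous_slow :: "(real \<Rightarrow> real) \<Rightarrow> bool" where
  "continuous_slow c \<longleftrightarrow>
     c ` {0<..<1} \<subseteq> {0<..<1} \<and> continuous_on {0<..<1} c \<and>
     (\<forall>\<eta>>0. Liminf (at_right 0) (\<lambda>r. ereal (c r * r powr (-\<eta>))) > 0)"

text \<open>
  \<open>v_over\<close> and \<open>v_under\<close> at \<open>\<kappa> = delta_index y b\<close> are the functions
  $\overline v$, $\underline v$; at \<open>\<kappa> = beta_index y b\<close> they are $\overline u$, $\underline u$.
  They take values in \<open>[0,\<infinity>]\<close>, so that \<open>inf {} = \<infinity>\<close> and \<open>sup {} = 0\<close>.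
\<close>

definition v_over ::
  "(real \<Rightarrow> real \<Rightarrow> real) \<Rightarrow> real \<Rightarrow> real \<Rightarrow> real \<Rightarrow> (real \<Rightarrow> real) \<Rightarrow> real \<Rightarrow> ennreal" where
  "v_over y b \<kappa> \<epsilon> c t =
     Inf (ennreal ` {s. 0 < s \<and>
       (\<forall>\<eta>\<in>{\<kappa>-\<epsilon>..<\<kappa>}. y s (t powr (1/\<eta>)) \<ge> c t * t * y b (t powr (1/\<eta>)))})"

definition v_under ::
  "(real \<Rightarrow> real \<Rightarrow> real) \<Rightarrow> real \<Rightarrow> real \<Rightarrow> real \<Rightarrow> (real \<Rightarrow> real) \<Rightarrow> real \<Rightarrow> ennreal" where
  "v_under y b \<kappa> \<epsilon> c t =
     Sup (ennreal ` {s. 0 < s \<and>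
       (\<forall>\<eta>\<in>{\<kappa><..\<kappa>+\<epsilon>}. y s (t powr (1/\<eta>)) \<le> inverse (c t) * t * y b (t powr (1/\<eta>)))})"

text \<open>
  The slow function entering \<open>v_over\<close> and \<open>v_under\<close> is not prescribed: the assertion is that
  the inequality holds, for all small \<open>t\<close>, with a suitable one.
\<close>

definition v_inequality :: "(real \<Rightarrow> real \<Rightarrow> real) \<Rightarrow> real \<Rightarrow> real \<Rightarrow> real \<Rightarrow> bool" where
  "v_inequality y b \<kappa> \<epsilon> \<longleftrightarrow>
     (\<exists>c. continuous_slow c \<and>
        (\<forall>\<^sub>F t in at_right 0. v_over y b \<kappa> \<epsilon> c t \<le> v_under y b \<kappa> \<epsilon> c t))"

section \<open>The three conditions\<close>

definition condition_i :: "(real \<Rightarrow> real \<Rightarrow> real) \<Rightarrow> real \<Rightarrow> bool" where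
  "condition_i y b \<longleftrightarrow>
     (\<exists>c1 c2. continuous_slow c1 \<and> continuous_slow c2 \<and>
        (\<exists>r0\<in>{0<..1}. \<forall>r1 r2 s. 0 < r1 \<and> r1 < r2 \<and> r2 < r0 \<and> 0 < s \<and> s < b \<longrightarrow>
           y s r2 / y b r2 \<le> inverse (c1 r1) * inverse (c2 r2) * (y s r1 / y b r1)))"

text \<open>Where \<open>y s\<close> vanishes identically, \<open>y s r / ydot y s r = 0\<close> and the inequality holds trivially, its right-hand side being positive.\<close>

definition condition_ii :: "(real \<Rightarrow> real \<Rightarrow> real) \<Rightarrow> real \<Rightarrow> bool" where
  "condition_ii y b \<longleftrightarrow>
     (\<exists>c. continuous_slow c \<and>
        (\<forall>\<^sub>F r in at_right 0. \<forall>s\<in>{0<..<b}.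
           y s r / ydot y s r - y b r / ydot y b r \<le> ln (c r) / ln r))"

definition f_over ::
  "(real \<Rightarrow> real \<Rightarrow> real) \<Rightarrow> real \<Rightarrow> (real \<Rightarrow> real) \<Rightarrow> (real \<Rightarrow> real) \<Rightarrow> real \<Rightarrow> real \<Rightarrow> real" where
  "f_over y b c v t \<eta> =
     min (ydot y (v t) (t powr (1/\<eta>)) / (c t * t * ydot y b (t powr (1/\<eta>)))) 1"

text \<open>A vanishing denominator makes the quotient infinite, hence its minimum with 1 equal to 1.\<close>

definition f_under ::
  "(real \<Rightarrow> real \<Rightarrow> real) \<Rightarrow> real \<Rightarrow> (real \<Rightarrow> real) \<Rightarrow> (real \<Rightarrow> real) \<Rightarrow> real \<Rightarrow> real \<Rightarrow> real" where
  "f_under y b c v t \<eta> =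
     (if ydot y (v t) (t powr (1/\<eta>)) = 0 then 1
      else min (c t * t * ydot y b (t powr (1/\<eta>)) / ydot y (v t) (t powr (1/\<eta>))) 1)"

definition condition_iii :: "(real \<Rightarrow> real \<Rightarrow> real) \<Rightarrow> real \<Rightarrow> real \<Rightarrow> bool" where
  "condition_iii y b \<kappa> \<longleftrightarrow>
     (\<exists>c v \<sigma> T \<epsilon>. continuous_slow c \<and> 0 < T \<and> T < 1 \<and> 0 < \<epsilon> \<and> \<epsilon> < \<kappa> \<and>
        continuous_on {0<..T} v \<and> (\<forall>t\<in>{0<..T}. 0 < v t) \<and>
        (\<forall>n. \<sigma> n \<in> {0<..T}) \<and> decseq \<sigma> \<and> \<sigma> \<longlonglongrightarrow> 0 \<and>
        (\<forall>n. v (\<sigma> n) = Inf {s. 0 < s \<and>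
           ydot y s (\<sigma> n powr (1/\<kappa>)) \<ge> c (\<sigma> n) * \<sigma> n * ydot y b (\<sigma> n powr (1/\<kappa>))}) \<and>
        uniformly_continuous_on ({0<..T} \<times> {\<kappa>-\<epsilon>..\<kappa>}) (\<lambda>(t, \<eta>). f_over y b c v t \<eta>) \<and>
        uniformly_continuous_on ({0<..T} \<times> {\<kappa>..\<kappa>+\<epsilon>}) (\<lambda>(t, \<eta>). f_under y b c v t \<eta>))"

end

theory Submission
  imports Defs
begin

text \<open>
  The function \<open>y\<close> is decreasing in \<open>r\<close> and \<open>r\<^sup>2 y\<close> is increasing, each up to a factor \<open>2\<close>, so that
  \<open>ydot\<close> is comparable to \<open>y\<close>. With \<open>r = t powr (1/\<kappa>)\<close>, condition (i) carries the comparison of \<open>y s\<close> with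
  \<open>t * y b\<close> at the radius \<open>r\<close> to all smaller radii if \<open>y s r\<close> is at least \<open>t * y b r\<close>, and to all larger
  radii otherwise: every \<open>s\<close> lies in one of the two sets that define \<open>v_over\<close> and \<open>v_under\<close>.
  Condition (ii) bounds the logarithmic derivative of \<open>ydot y s / ydot y b\<close> and gives (i) by integration.
  Under (iii), both \<open>f_over\<close> and \<open>f_under\<close> are bounded below at the points \<open>(\<sigma> n, \<kappa>)\<close>, hence near \<open>(0, \<kappa>)\<close> by
  uniform continuity, so that \<open>v t\<close> lies in both sets.
\<close>

section \<open>Slow functions\<close>

text \<open>Under (i) and (ii), lower bounds come one exponent at a time, as
  \<open>A * r powr \<eta>\<close> with \<open>A\<close> depending on \<open>\<eta>\<close>, whereas
  the conclusion wants a single continuous slow function. This is the recurring obstacle.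
  \<open>continuous_slow_minorant\<close> takes a whole set of values at each point because one
  function has to undercut a family indexed by times, radii or exponents. In (iii) the values
  \<open>v (\<sigma> n)\<close> are only infima over times, so a level is met there up to a constant
  by continuity of \<open>y\<close> in time. That is the reason for the work on time continuity of
  the integrals against \<open>\<nu>\<close> and on running suprema. Measurability of
  \<open>y\<close> in the radius serves the averages: \<open>ydot\<close> is governed by the
  primitive of the reciprocal of \<open>y\<close>, which has to be integrable. Quotients stay
  harmless because \<open>y s\<close> is either identically zero or positive at every
  radius.\<close>

lemma continuous_slow_bounds:
  assumes "continuous_slow c" "0 < r" "r < 1"
  shows "0 < c r" "c r < 1"
  using assms unfolding continuous_slow_def by (force simp: image_subset_iff)+

text \<open>The liminf condition gives the bound near 0, and on the remaining compact interval a
  positive continuous function has a positive minimum. The interval ends at \<open>r0 < 1\<close>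
  because \<open>c\<close> may tend to 0 at 1.\<close>

lemma continuous_slow_lower:
  assumes c: "continuous_slow c" and \<eta>: "0 < \<eta>" and r0: "r0 < 1"
  obtains A where "0 < A" "\<And>r. 0 < r \<Longrightarrow> r \<le> r0 \<Longrightarrow> A * r powr \<eta> \<le> c r"
proof -
  note cpos = continuous_slow_bounds(1)[OF c]
  have ccont: "continuous_on {0<..<1} c"
    and cl: "Liminf (at_right 0) (\<lambda>r. ereal (c r * r powr (-\<eta>))) > 0"
    using c \<eta> unfolding continuous_slow_def by auto
  obtain a where a: "0 < ereal a" "ereal a < Liminf (at_right 0) (\<lambda>r. ereal (c r * r powr (-\<eta>)))"
    using ereal_dense2[OF cl] by auto
  have "\<forall>\<^sub>F r in at_right 0. ereal a < ereal (c r * r powr (-\<eta>))"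
    by (rule less_LiminfD[OF a(2)])
  then obtain d where d: "0 < d" "\<And>r. 0 < r \<Longrightarrow> r < d \<Longrightarrow> a < c r * r powr (-\<eta>)"
    unfolding eventually_at_right_field by auto
  have small: "a * r powr \<eta> \<le> c r" if "0 < r" "r < d" for r
  proof -
    have "a * r powr \<eta> \<le> (c r * r powr (-\<eta>)) * r powr \<eta>"
      using d(2)[OF that] by (intro mult_right_mono) auto
    also have "\<dots> = c r" using that by (simp add: powr_minus field_simps)
    finally show ?thesis .
  qed
  obtain m where m: "0 < m" "\<And>r. d \<le> r \<Longrightarrow> r \<le> r0 \<Longrightarrow> m \<le> c r"
  proof (cases "d \<le> r0")
    case True
    have "continuous_on {d..r0} c"
      using ccont by (rule continuous_on_subset) (use d r0 in auto)
    then obtain x where x: "x \<in> {d..r0}" "\<And>r. r \<in> {d..r0} \<Longrightarrow> c x \<le> c r"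
      using continuous_attains_inf[of "{d..r0}" c] True by auto
    then show ?thesis using that[of "c x"] cpos[of x] d r0 by auto
  next
    case False
    then show ?thesis using that[of 1] by auto
  qed
  show ?thesis
  proof (rule that[of "min a m"])
    show "0 < min a m" using a m by auto
    fix r assume r: "0 < r" "r \<le> r0"
    have p: "r powr \<eta> \<le> 1" using r r0 \<eta> by (simp add: powr_le1)
    show "min a m * r powr \<eta> \<le> c r"
    proof (cases "r < d")
      case True
      have "min a m * r powr \<eta> \<le> a * r powr \<eta>" by (intro mult_right_mono) auto
      then show ?thesis using small[of r] r True by linarith
    next
      case False
      have "min a m * r powr \<eta> \<le> m * 1" using p m(1) a by (intro mult_mono) auto
      then show ?thesis using m(2)[of r] False r by auto
    qed
  qed
qed

lemma continuous_slowI: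
  assumes "\<And>r. 0 < r \<Longrightarrow> r < 1 \<Longrightarrow> 0 < c r \<and> c r < 1" "continuous_on {0<..<1} c"
    and low: "\<And>\<eta>. 0 < \<eta> \<Longrightarrow> \<exists>A>0. \<forall>\<^sub>F r in at_right 0. A * r powr \<eta> \<le> c r"
  shows "continuous_slow c"
  unfolding continuous_slow_def
proof (intro conjI allI impI)
  show "c ` {0<..<1} \<subseteq> {0<..<1}" using assms(1) by force
  show "continuous_on {0<..<1} c" by fact
  fix \<eta> :: real assume "0 < \<eta>"
  from low[OF this] obtain A where A: "0 < A" "\<forall>\<^sub>F r in at_right 0. A * r powr \<eta> \<le> c r" by auto
  have "\<forall>\<^sub>F r in at_right (0::real). ereal A \<le> ereal (c r * r powr (-\<eta>))"
    using A(2) eventually_at_right_less[of "0::real"]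
    by eventually_elim (simp add: powr_minus field_simps)
  then have "ereal A \<le> Liminf (at_right 0) (\<lambda>r. ereal (c r * r powr (-\<eta>)))"
    by (rule Liminf_bounded)
  then show "0 < Liminf (at_right 0) (\<lambda>r. ereal (c r * r powr (-\<eta>)))"
    using A(1) by (simp add: less_le_trans[of 0 "ereal A"])
qed

lemma continuous_slow_const:
  assumes "0 < k" "k < 1"
  shows "continuous_slow (\<lambda>_. k)"
proof (rule continuous_slowI)
  fix \<eta> :: real assume \<eta>: "0 < \<eta>"
  have "\<forall>\<^sub>F r in at_right (0::real). k * r powr \<eta> \<le> k"
    unfolding eventually_at_right_field
    by (rule exI[of _ 1]) (use assms \<eta> in \<open>auto simp: powr_le1 mult_left_le\<close>)
  then show "\<exists>A>0. \<forall>\<^sub>F r in at_right 0. A * r powr \<eta> \<le> k" using assms by blast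
qed (use assms in auto)

lemma continuous_slow_cmult:
  assumes c: "continuous_slow c" and k: "0 < k" "k \<le> 1"
  shows "continuous_slow (\<lambda>r. k * c r)"
proof (rule continuous_slowI)
  fix r :: real assume "0 < r" "r < 1"
  from continuous_slow_bounds[OF c this] have "0 < c r" "c r < 1" .
  then show "0 < k * c r \<and> k * c r < 1" 
    using k by (auto intro: le_less_trans[OF mult_left_le_one_le])
next
  show "continuous_on {0<..<1} (\<lambda>r. k * c r)"
    using c unfolding continuous_slow_def by (auto intro: continuous_intros)
next
  fix \<eta> :: real assume "0 < \<eta>"
  then obtain A where A: "0 < A" "\<And>r. 0 < r \<Longrightarrow> r \<le> 1/2 \<Longrightarrow> A * r powr \<eta> \<le> c r"
    using continuous_slow_lower[OF c, of \<eta> "1/2"] by auto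
  have "\<forall>\<^sub>F r in at_right (0::real). (k * A) * r powr \<eta> \<le> k * c r"
    unfolding eventually_at_right_field
    by (rule exI[of _ "1/2"]) (use A k in \<open>auto simp: mult.assoc\<close>)
  then show "\<exists>A>0. \<forall>\<^sub>F r in at_right 0. A * r powr \<eta> \<le> k * c r"
    using A k by (intro exI[of _ "k * A"]) auto
qed

text \<open>In the variable \<open>x = - ln r\<close> the hypothesis bounds \<open>- ln a\<close> by a family of affine functions whose
  slopes tend to \<open>0\<close>. Their infimum is concave, hence continuous.\<close>

lemma continuous_slow_minorant:
  fixes Z :: "real \<Rightarrow> real set"
  assumes r0: "r0 \<le> 1"
    and low: "\<And>\<eta>. 0 < \<eta> \<Longrightarrow> \<exists>A>0. \<forall>r a. 0 < r \<longrightarrow> r < r0 \<longrightarrow> a \<in> Z r \<longrightarrow> A * r powr \<eta> \<le> a"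
  obtains c where "continuous_slow c" "\<And>r a. 0 < r \<Longrightarrow> r < r0 \<Longrightarrow> a \<in> Z r \<Longrightarrow> c r \<le> a"
proof -
  have "\<forall>n. \<exists>A>0. \<forall>r a. 0 < r \<longrightarrow> r < r0 \<longrightarrow> a \<in> Z r \<longrightarrow> A * r powr (1 / real (Suc n)) \<le> a"
    by (intro allI low) auto
  then obtain A where A: "\<And>n. 0 < A n"
    "\<And>n r a. 0 < r \<Longrightarrow> r < r0 \<Longrightarrow> a \<in> Z r \<Longrightarrow> A n * r powr (1 / real (Suc n)) \<le> a"
    unfolding choice_iff by auto
  \<comment> \<open>The floor \<open>ln 2\<close> bounds the affine family below, so that its
    infimum exists, and gives \<open>c r \<le> 1/2\<close>, hence values below 1.\<close>
  define D where "D n = max (ln 2) (- ln (A n))" for n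
  define N where "N x = (INF n. x / real (Suc n) + D n)" for x
  have D: "ln 2 \<le> D n" for n unfolding D_def by auto
  have bdd: "bdd_below (range (\<lambda>n. x / real (Suc n) + D n))" if "0 < x" for x
    by (rule bdd_belowI2[of _ "ln 2"]) (use D that in \<open>auto intro!: add_nonneg_nonneg add_increasing\<close>)
  have Nle: "N x \<le> x / real (Suc n) + D n" if "0 < x" for x n
    unfolding N_def by (rule cINF_lower[OF bdd[OF that]]) auto
  have Nge: "ln 2 \<le> N x" if "0 < x" for x
    unfolding N_def by (rule cINF_greatest) (use D that in \<open>auto intro!: add_increasing\<close>)
  have "convex_on {0<..} (\<lambda>x. - N x)"
  proof (rule convex_onI)
    fix t x y :: real assume t: "0 < t" "t < 1" and xy: "x \<in> {0<..}" "y \<in> {0<..}"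
    have "(1 - t) * N x + t * N y \<le> N ((1 - t) * x + t * y)"
      unfolding N_def[of "(1 - t) * x + t * y"]
    proof (rule cINF_greatest)
      fix n
      have "(1 - t) * N x + t * N y
         \<le> (1 - t) * (x / real (Suc n) + D n) + t * (y / real (Suc n) + D n)"
        using t xy by (intro add_mono mult_left_mono Nle) auto
      also have "\<dots> = ((1 - t) * x + t * y) / real (Suc n) + D n"
        by (simp add: algebra_simps add_divide_distrib diff_divide_distrib del: of_nat_Suc)
      finally show "(1 - t) * N x + t * N y \<le> ((1 - t) * x + t * y) / real (Suc n) + D n" .
    qed auto
    then show "- N ((1 - t) *\<^sub>R x + t *\<^sub>R y) \<le> (1 - t) * - N x + t * - N y" by simp
  qed (simp add: convex_real_interval)
  then have "continuous_on {0<..} (\<lambda>x. - N x)"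
    by (rule convex_on_continuous[rotated]) auto
  then have Ncont: "continuous_on {0<..} N"
    using continuous_on_minus by fastforce
  define c where "c r = exp (- N (- ln r))" for r
  show ?thesis
  proof (rule that)
    show "continuous_slow c"
    proof (rule continuous_slowI)
      fix r :: real assume "0 < r" "r < 1"
      then have "0 < - ln r" by simp
      from Nge[OF this] have "0 < N (- ln r)" using ln_gt_zero[of "2::real"] by linarith
      then show "0 < c r \<and> c r < 1" unfolding c_def by simp
    next
      show "continuous_on {0<..<1} c" unfolding c_def
        by (intro continuous_intros continuous_on_compose2[OF Ncont]) auto
    next
      fix \<eta> :: real assume "0 < \<eta>"
      then obtain n where n: "1 / real (Suc n) < \<eta>"
        using nat_approx_posE by blast
      have "exp (- D n) * r powr \<eta> \<le> c r" if r: "0 < r" "r < 1" for r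
      proof -
        have "exp (- D n) * r powr \<eta> \<le> exp (- D n) * r powr (1 / real (Suc n))"
          using r n by (intro mult_left_mono powr_mono') auto
        also have "\<dots> = exp (- (- ln r / real (Suc n) + D n))"
          using r by (simp add: powr_def exp_add[symmetric])
        also have "\<dots> \<le> c r" unfolding c_def using Nle[of "- ln r" n] r by simp
        finally show ?thesis .
      qed
      then have "\<forall>\<^sub>F r in at_right (0::real). exp (- D n) * r powr \<eta> \<le> c r"
        unfolding eventually_at_right_field by (intro exI[of _ 1]) auto
      then show "\<exists>A>0. \<forall>\<^sub>F r in at_right 0. A * r powr \<eta> \<le> c r"
        by (intro exI[of _ "exp (- D n)"]) auto
    qed
  next
    fix r a assume r: "0 < r" "r < r0" and a: "a \<in> Z r"
    have apos: "0 < a"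
      using A(2)[OF r a, of 0] A(1)[of 0] r by (auto intro: less_le_trans[rotated])
    have "- ln a \<le> N (- ln r)" unfolding N_def
    proof (rule cINF_greatest)
      fix n
      have "ln (A n * r powr (1 / real (Suc n))) \<le> ln a"
        using A(2)[OF r a, of n] A(1)[of n] r apos by simp
      also have "ln (A n * r powr (1 / real (Suc n))) = ln (A n) + ln r / real (Suc n)"
        using A(1)[of n] r by (simp add: ln_mult ln_powr)
      finally show "- ln a \<le> - ln r / real (Suc n) + D n" unfolding D_def by auto
    qed auto
    then have "c r \<le> exp (ln a)" unfolding c_def by simp
    then show "c r \<le> a" using apos by simp
  qed
qed

section \<open>Regularity of \<open>y\<close> in time and radius\<close>

abbreviation levy_weight :: "real \<Rightarrow> real" where
  "levy_weight x \<equiv> min 1 (x\<^sup>2)"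

lemma levy_measure_integrable:
  assumes \<mu>: "levy_measure \<mu>" and f: "f \<in> borel_measurable borel"
    and bound: "\<And>x. \<bar>f x\<bar> \<le> k * levy_weight x"
  shows "integrable \<mu> f"
proof -
  have sets: "sets \<mu> = sets borel" using \<mu> unfolding levy_measure_def by simp
  have meas: "g \<in> borel_measurable \<mu>" if "g \<in> borel_measurable borel" for g :: "real \<Rightarrow> real"
    using that measurable_cong_sets[OF sets refl] by blast
  have "integrable \<mu> levy_weight"
  proof (rule integrableI_nonneg)
    show "levy_weight \<in> borel_measurable \<mu>" by (rule meas) measurable
    show "(\<integral>\<^sup>+ x. ennreal (levy_weight x) \<partial>\<mu>) < \<infinity>" using \<mu> unfolding levy_measure_def by simp
  qed auto
  then have "integrable \<mu> (\<lambda>x. k * levy_weight x)" by simp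
  then show ?thesis
    by (rule Bochner_Integration.integrable_bound)
       (auto intro!: meas f simp: order_trans[OF bound abs_ge_self])
qed

lemma levy_weight_lower:
  assumes "0 < r" "r < \<bar>x\<bar>"
  shows "1 \<le> max 1 (1 / r\<^sup>2) * levy_weight x"
proof (cases "x\<^sup>2 \<le> 1")
  case True
  have "r\<^sup>2 \<le> x\<^sup>2" using assms by (metis abs_le_square_iff abs_of_pos less_imp_le)
  then have "1 \<le> (1 / r\<^sup>2) * x\<^sup>2" using assms by (simp add: field_simps)
  also have "\<dots> \<le> max 1 (1 / r\<^sup>2) * x\<^sup>2" by (intro mult_right_mono) auto
  finally show ?thesis using True by simp
qed auto

lemma levy_weight_upper:
  assumes "\<bar>x\<bar> \<le> r"
  shows "x\<^sup>2 \<le> max 1 (r\<^sup>2) * levy_weight x"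
proof (cases "x\<^sup>2 \<le> 1")
  case True
  have "1 * x\<^sup>2 \<le> max 1 (r\<^sup>2) * x\<^sup>2" by (intro mult_right_mono) auto
  then show ?thesis using True by simp
next
  case False
  have "x\<^sup>2 \<le> r\<^sup>2" using assms by (simp add: abs_le_square_iff[symmetric])
  then show ?thesis using False by auto
qed

text \<open>When \<open>s\<close> grows to \<open>t\<close> with \<open>t - s\<close> small, every
  new point is close to \<open>s\<close>, so uniform continuity on a compact interval limits the
  growth of the supremum. Applied to \<open>M_fun\<close> it yields the time continuity of
  \<open>Mstar_fun\<close>.\<close>

lemma continuous_on_running_Sup:
  fixes g :: "real \<Rightarrow> real"
  assumes g: "continuous_on {0..} g"
  shows "continuous_on {0..} (\<lambda>t. SUP s\<in>{0..t}. g s)"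
proof -
  let ?m = "\<lambda>t. SUP s\<in>{0..t}. g s"
  have bdd: "bdd_above (g ` {0..t})" for t
  proof -
    have "compact (g ` {0..t})"
      by (rule compact_continuous_image[OF continuous_on_subset[OF g]]) auto
    then show ?thesis by (simp add: bounded_imp_bdd_above compact_imp_bounded)
  qed
  have mono: "?m s \<le> ?m t" if "0 \<le> s" "s \<le> t" for s t
    using that by (intro cSUP_subset_mono bdd) auto
  have unif: "continuous_on {0..T} ?m" for T
    unfolding continuous_on_iff
  proof (intro ballI allI impI)
    fix x e :: real assume x: "x \<in> {0..T}" and e: "0 < e"
    have "uniformly_continuous_on {0..T} g"
      by (rule compact_uniformly_continuous[OF continuous_on_subset[OF g]]) auto
    then obtain d where d: "0 < d"
      "\<And>u v. u \<in> {0..T} \<Longrightarrow> v \<in> {0..T} \<Longrightarrow> dist u v < d \<Longrightarrow> dist (g u) (g v) < e / 2"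
      unfolding uniformly_continuous_on_def using e by (meson half_gt_zero)
    have step: "?m t \<le> ?m s + e / 2" if "s \<in> {0..T}" "t \<in> {0..T}" "s \<le> t" "t - s < d" for s t
    proof (rule cSUP_least)
      fix u assume u: "u \<in> {0..t}"
      show "g u \<le> ?m s + e / 2"
      proof (cases "u \<le> s")
        case True
        then have "g u \<le> ?m s" using u by (intro cSUP_upper bdd) auto
        then show ?thesis using e by simp
      next
        case False
        then have "dist (g u) (g s) < e / 2" using u that by (intro d(2)) (auto simp: dist_real_def)
        moreover have "g s \<le> ?m s" using that by (intro cSUP_upper bdd) auto
        ultimately show ?thesis unfolding dist_real_def by linarith
      qed
    qed (use that in auto)
    show "\<exists>d>0. \<forall>x'\<in>{0..T}. dist x' x < d \<longrightarrow> dist (?m x') (?m x) < e"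
    proof (intro exI[of _ d] conjI ballI impI d(1))
      fix x' assume x': "x' \<in> {0..T}" "dist x' x < d"
      show "dist (?m x') (?m x) < e"
      proof (cases "x \<le> x'")
        case True
        then show ?thesis using step[of x x'] mono[of x x'] x x' e
          unfolding dist_real_def by auto
      next
        case False
        then show ?thesis using step[of x' x] mono[of x' x] x x' e
          unfolding dist_real_def by auto
      qed
    qed
  qed
  \<comment> \<open>From compact intervals to the half line: \<open>{..<real T}\<close> is an open
    neighbourhood of each \<open>x < real T\<close>, and within it the half line and
    \<open>{0..real T}\<close> coincide.\<close>
  show ?thesis
  proof (rule continuous_on_subset[of "\<Union>T::nat. {0..<real T}"])
    show "continuous_on (\<Union>T::nat. {0..<real T}) ?m"
      unfolding continuous_on_eq_continuous_within
    proof
      fix x assume "x \<in> (\<Union>T::nat. {0..<real T})"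
      then obtain T :: nat where T: "0 \<le> x" "x < real T" by auto
      have "continuous (at x within {0..real T}) ?m"
        using unif[of "real T"] T unfolding continuous_on_eq_continuous_within by auto
      moreover have "at x within {0..real T} = at x within (\<Union>T::nat. {0..<real T})"
      proof (rule at_within_nhd[of _ "{..<real T}"])
        have "\<exists>n. y < real n" for y by (rule reals_Archimedean2)
        then show "{0..real T} \<inter> {..<real T} - {x} = (\<Union>T::nat. {0..<real T}) \<inter> {..<real T} - {x}"
          using T by force
      qed (use T in auto)
      ultimately show "continuous (at x within (\<Union>T::nat. {0..<real T})) ?m" by simp
    qed
    show "{0..} \<subseteq> (\<Union>T::nat. {0..<real T})"
      using reals_Archimedean2 by (force simp: set_eq_iff)
  qed
qed

section \<open>Integrals against an increasing family of Levy measures\<close>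

locale characteristics =
  fixes B C :: "real \<Rightarrow> real" and \<nu> :: "real \<Rightarrow> real measure"
  assumes B_cont: "continuous_on {0..} B"
    and C_cont: "continuous_on {0..} C" and C_mono: "mono_on {0..} C" and C_0: "C 0 = 0"
    and levy: "\<And>t. 0 \<le> t \<Longrightarrow> levy_measure (\<nu> t)"
    and \<nu>_mono: "\<And>A s t. A \<in> sets borel \<Longrightarrow> 0 \<le> s \<Longrightarrow> s \<le> t \<Longrightarrow> emeasure (\<nu> s) A \<le> emeasure (\<nu> t) A"
    and \<nu>_cont: "\<And>A r. A \<in> sets borel \<Longrightarrow> 0 < r \<Longrightarrow> (\<And>x. x \<in> A \<Longrightarrow> r < \<bar>x\<bar>) \<Longrightarrow>
        continuous_on {0..} (\<lambda>t. measure (\<nu> t) A)"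
begin

lemma sets_\<nu>: "0 \<le> t \<Longrightarrow> sets (\<nu> t) = sets borel"
  using levy unfolding levy_measure_def by auto

lemma space_\<nu>: "0 \<le> t \<Longrightarrow> space (\<nu> t) = UNIV"
  using sets_eq_imp_space_eq[OF sets_\<nu>] by simp

lemma integrable_\<nu>:
  assumes "0 \<le> t" "f \<in> borel_measurable borel" "\<And>x. \<bar>f x\<bar> \<le> k * levy_weight x"
  shows "integrable (\<nu> t) f"
  using levy_measure_integrable[OF levy] assms by blast

lemma integral_mono_time:
  assumes st: "0 \<le> s" "s \<le> t" and f: "f \<in> borel_measurable borel"
    and bound: "\<And>x. 0 \<le> f x" "\<And>x. f x \<le> k * levy_weight x"
  shows "(LINT x|\<nu> s. f x) \<le> (LINT x|\<nu> t. f x)"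
proof -
  have int: "integrable (\<nu> u) f" if "0 \<le> u" for u
    using that by (rule integrable_\<nu>[where k = k, OF _ f]) (use bound in auto)
  have "\<nu> s \<le> \<nu> t"
    using st \<nu>_mono by (subst le_measure) (auto simp: sets_\<nu> le_fun_def emeasure_notin_sets)
  then have "(\<integral>\<^sup>+x. f x \<partial>\<nu> s) \<le> (\<integral>\<^sup>+x. f x \<partial>\<nu> t)"
    using st by (intro nn_integral_mono_measure) (auto simp: sets_\<nu>)
  then show ?thesis
    using st bound(1) int by (simp add: nn_integral_eq_integral integral_nonneg_AE)
qed

text \<open>The increment of \<open>\<nu>\<close> from \<open>s\<close> to \<open>t\<close> is a
  positive measure, and this is the triangle inequality for it. To avoid subtracting measures,
  monotonicity is applied to the nonnegative functions \<open>g + f\<close> and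
  \<open>g - f\<close>.\<close>

lemma integral_diff_time:
  assumes st: "0 \<le> s" "s \<le> t" and f: "f \<in> borel_measurable borel" and g: "g \<in> borel_measurable borel"
    and fg: "\<And>x. \<bar>f x\<bar> \<le> g x" and gk: "\<And>x. g x \<le> k * levy_weight x"
  shows "\<bar>(LINT x|\<nu> t. f x) - (LINT x|\<nu> s. f x)\<bar> \<le> (LINT x|\<nu> t. g x) - (LINT x|\<nu> s. g x)"
proof -
  have g0: "0 \<le> g x" for x using fg[of x] by linarith
  have intg: "integrable (\<nu> u) g" if "0 \<le> u" for u
    using that by (rule integrable_\<nu>[where k = k, OF _ g]) (use g0 gk in auto)
  have intf: "integrable (\<nu> u) f" if "0 \<le> u" for u
    using that by (rule integrable_\<nu>[where k = k, OF _ f]) (use fg gk order_trans in blast)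
  have "(LINT x|\<nu> s. g x + f x) \<le> (LINT x|\<nu> t. g x + f x)"
  proof (rule integral_mono_time[OF st, where k = "2 * k"])
    fix x
    show "0 \<le> g x + f x" "g x + f x \<le> 2 * k * levy_weight x"
      using fg[of x] gk[of x] by linarith+
  qed (use f g in measurable)
  moreover have "(LINT x|\<nu> s. g x - f x) \<le> (LINT x|\<nu> t. g x - f x)"
  proof (rule integral_mono_time[OF st, where k = "2 * k"])
    fix x
    show "0 \<le> g x - f x" "g x - f x \<le> 2 * k * levy_weight x"
      using fg[of x] gk[of x] by linarith+
  qed (use f g in measurable)
  ultimately show ?thesis using st intf intg by (simp add: abs_le_iff)
qed

text \<open>Continuity of \<open>\<nu> t A\<close> is available only for \<open>A\<close> away from the origin. The mass near the
  origin is small uniformly for \<open>t \<le> T\<close> because \<open>\<nu> t \<le> \<nu> T\<close>.\<close>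

lemma levy_weight_continuous_time: "continuous_on {0..} (\<lambda>t. LINT x|\<nu> t. levy_weight x)"
  unfolding continuous_on_iff
proof (intro ballI allI impI)
  fix t0 e :: real assume t0: "t0 \<in> {0..}" and e: "0 < e"
  \<comment> \<open>A common upper time for all \<open>t\<close> within distance 1 of
    \<open>t0\<close>; the final radius is \<open>min d 1\<close> for this reason.\<close>
  define T where "T = t0 + 1"
  have T: "0 \<le> T" using t0 by (simp add: T_def)
  let ?v = "\<lambda>h x. indicator {x. \<bar>x\<bar> \<le> h} x * levy_weight x"
  have wint: "integrable (\<nu> t) levy_weight" if "0 \<le> t" for t
    by (rule integrable_\<nu>[OF that, where k = 1]) auto
  have "(\<lambda>n. LINT x|\<nu> T. ?v (1 / real (Suc n)) x) \<longlonglongrightarrow> (LINT x|\<nu> T. 0)"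
  proof (rule integral_dominated_convergence[where w = levy_weight])
    show "AE x in \<nu> T. (\<lambda>n. ?v (1 / real (Suc n)) x) \<longlonglongrightarrow> 0"
    proof (intro AE_I2)
      fix x :: real
      show "(\<lambda>n. ?v (1 / real (Suc n)) x) \<longlonglongrightarrow> 0"
      proof (cases "x = 0")
        case False
        have "(\<lambda>n. 1 / real (Suc n)) \<longlonglongrightarrow> 0" by (rule lim_1_over_n[THEN LIMSEQ_Suc])
        then have "\<forall>\<^sub>F n in sequentially. 1 / real (Suc n) < \<bar>x\<bar>"
          by (rule order_tendstoD(2)) (use False in auto)
        then have "\<forall>\<^sub>F n in sequentially. ?v (1 / real (Suc n)) x = 0"
          by eventually_elim auto
        then show ?thesis by (rule tendsto_eventually)
      qed simp
    qed
    show "integrable (\<nu> T) levy_weight" by (rule wint[OF T])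
    show "AE x in \<nu> T. norm (?v (1 / real (Suc n)) x) \<le> levy_weight x" for n
      by (intro AE_I2) (auto split: split_indicator)
  qed (auto simp: measurable_cong_sets[OF sets_\<nu>[OF T] refl])
  then have "(\<lambda>n. LINT x|\<nu> T. ?v (1 / real (Suc n)) x) \<longlonglongrightarrow> 0" by simp
  from order_tendstoD(2)[OF this, of "e / 2"] e
  have "\<forall>\<^sub>F n in sequentially. (LINT x|\<nu> T. ?v (1 / real (Suc n)) x) < e / 2" by simp
  then obtain n where n: "(LINT x|\<nu> T. ?v (1 / real (Suc n)) x) < e / 2"
    using eventually_happens trivial_limit_sequentially by blast
  define h where "h = 1 / real (Suc n)"
  have h: "0 < h" "(LINT x|\<nu> T. ?v h x) < e / 2" using n by (auto simp: h_def)
  let ?A = "{x. h < \<bar>x\<bar>}"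
  let ?k = "max 1 (1 / h\<^sup>2)"
  have A: "indicat_real ?A x \<le> ?k * levy_weight x" for x
    using levy_weight_lower[OF h(1), of x] by (auto split: split_indicator)
  have Aint: "integrable (\<nu> t) (indicat_real ?A)" if "0 \<le> t" for t
    by (rule integrable_\<nu>[OF that, where k = ?k]) (use A in \<open>auto simp: indicator_abs_le_1\<close>)
  have NA: "measure (\<nu> t) ?A = (LINT x|\<nu> t. indicat_real ?A x)" if "0 \<le> t" for t
    using space_\<nu>[OF that] by simp
  \<comment> \<open>The weight is at most 1, so away from the origin its integral grows by no more
    than the mass of \<open>?A\<close>. Near the origin, the part at time \<open>t\<close> is
    bounded by the one at \<open>T\<close>, and the part at time \<open>s\<close> is dropped as
    nonnegative.\<close>
  have step: "(LINT x|\<nu> t. levy_weight x) - (LINT x|\<nu> s. levy_weight x)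
      \<le> (measure (\<nu> t) ?A - measure (\<nu> s) ?A) + (LINT x|\<nu> T. ?v h x)"
    if st: "0 \<le> s" "s \<le> t" "t \<le> T" for s t
  proof -
    have vint: "integrable (\<nu> t) (?v h)" if "0 \<le> t" for t
      by (rule integrable_\<nu>[OF that, where k = 1]) (auto split: split_indicator)
    have iint: "integrable (\<nu> t) (\<lambda>x. indicator ?A x * levy_weight x)" if "0 \<le> t" for t
      by (rule integrable_\<nu>[OF that, where k = 1]) (auto split: split_indicator)
    have split: "(LINT x|\<nu> t. levy_weight x)
        = (LINT x|\<nu> t. indicator ?A x * levy_weight x) + (LINT x|\<nu> t. ?v h x)" if "0 \<le> t" for t
      unfolding Bochner_Integration.integral_add[OF iint[OF that] vint[OF that], symmetric]
      by (intro Bochner_Integration.integral_cong) (auto split: split_indicator)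
    have "\<bar>(LINT x|\<nu> t. indicator ?A x * levy_weight x) - (LINT x|\<nu> s. indicator ?A x * levy_weight x)\<bar>
        \<le> (LINT x|\<nu> t. indicat_real ?A x) - (LINT x|\<nu> s. indicat_real ?A x)"
      by (rule integral_diff_time[OF st(1,2), where k = ?k]) (use A in \<open>auto split: split_indicator\<close>)
    moreover have "(LINT x|\<nu> t. ?v h x) \<le> (LINT x|\<nu> T. ?v h x)"
      by (rule integral_mono_time[where k = 1]) (use st in \<open>auto split: split_indicator\<close>)
    moreover have "0 \<le> (LINT x|\<nu> s. ?v h x)"
      by (intro integral_nonneg_AE AE_I2) auto
    ultimately show ?thesis
      using split[OF st(1)] split[OF order_trans[OF st(1,2)]]
        NA[OF st(1)] NA[OF order_trans[OF st(1,2)]] by linarith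
  qed
  have "continuous_on {0..} (\<lambda>t. measure (\<nu> t) ?A)" by (rule \<nu>_cont[OF _ h(1)]) auto
  then obtain d where d: "0 < d"
    "\<And>t. 0 \<le> t \<Longrightarrow> \<bar>t - t0\<bar> < d \<Longrightarrow> \<bar>measure (\<nu> t) ?A - measure (\<nu> t0) ?A\<bar> < e / 2"
    unfolding continuous_on_iff dist_real_def using t0 e by (metis atLeast_iff half_gt_zero)
  have mono: "(LINT x|\<nu> s. levy_weight x) \<le> (LINT x|\<nu> t. levy_weight x)" if "0 \<le> s" "s \<le> t" for s t
    by (rule integral_mono_time[OF that, where k = 1]) auto
  show "\<exists>d>0. \<forall>t\<in>{0..}. dist t t0 < d \<longrightarrow>
      dist (LINT x|\<nu> t. levy_weight x) (LINT x|\<nu> t0. levy_weight x) < e"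
  proof (intro exI[of _ "min d 1"] conjI ballI impI)
    fix t assume t: "t \<in> {0..}" "dist t t0 < min d 1"
    then have td: "\<bar>t - t0\<bar> < d" "t \<le> T" "0 \<le> t" by (auto simp: dist_real_def T_def)
    show "dist (LINT x|\<nu> t. levy_weight x) (LINT x|\<nu> t0. levy_weight x) < e"
    proof (cases "t \<le> t0")
      case True
      from step[OF td(3) True] mono[OF td(3) True] d(2)[OF td(3,1)] h(2) show ?thesis
        unfolding dist_real_def T_def by linarith
    next
      case False
      then have le: "t0 \<le> t" by simp
      have "0 \<le> t0" using t0 by simp
      from step[OF this le td(2)] mono[OF this le] d(2)[OF td(3,1)] h(2) show ?thesis
        unfolding dist_real_def by linarith
    qed
  qed (use d in auto)
qed

text \<open>Increments in time of the integral of \<open>f\<close> are dominated by those of the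
  weight, so continuity for the single function \<open>levy_weight\<close> is enough.\<close>

lemma integral_continuous_time:
  assumes f: "f \<in> borel_measurable borel" and bound: "\<And>x. \<bar>f x\<bar> \<le> k * levy_weight x"
  shows "continuous_on {0..} (\<lambda>t. LINT x|\<nu> t. f x)"
proof -
  let ?m = "\<lambda>t. LINT x|\<nu> t. levy_weight x"
  have diff: "\<bar>(LINT x|\<nu> t. f x) - (LINT x|\<nu> s. f x)\<bar> \<le> k * (?m t - ?m s)" if "0 \<le> s" "s \<le> t" for s t
  proof -
    have "\<bar>(LINT x|\<nu> t. f x) - (LINT x|\<nu> s. f x)\<bar>
        \<le> (LINT x|\<nu> t. k * levy_weight x) - (LINT x|\<nu> s. k * levy_weight x)"
      by (rule integral_diff_time[OF that f _ bound order_refl]) measurable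
    then show ?thesis by (simp add: right_diff_distrib)
  qed
  show ?thesis
    unfolding continuous_on_def
  proof
    fix t0 :: real assume t0: "t0 \<in> {0..}"
    have "(?m \<longlongrightarrow> ?m t0) (at t0 within {0..})"
      using levy_weight_continuous_time t0 unfolding continuous_on_def by blast
    from tendsto_mult_left[OF tendsto_rabs_zero[OF LIM_zero[OF this]], of k]
    have "((\<lambda>t. k * \<bar>?m t - ?m t0\<bar>) \<longlongrightarrow> 0) (at t0 within {0..})" by simp
    then have "((\<lambda>t. (LINT x|\<nu> t. f x) - (LINT x|\<nu> t0. f x)) \<longlongrightarrow> 0) (at t0 within {0..})"
    proof (rule Lim_null_comparison[rotated])
      have "norm ((LINT x|\<nu> t. f x) - (LINT x|\<nu> t0. f x)) \<le> k * \<bar>?m t - ?m t0\<bar>" if t: "0 \<le> t" for t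
      proof (cases "t \<le> t0")
        case True
        have "?m t \<le> ?m t0" by (rule integral_mono_time[OF t True, where k = 1]) auto
        with diff[OF t True] show ?thesis by (simp add: abs_minus_commute)
      next
        case False
        then have "?m t0 \<le> ?m t" using t0 by (intro integral_mono_time[where k = 1]) auto
        with diff[of t0 t] False t0 show ?thesis by simp
      qed
      then show "\<forall>\<^sub>F t in at t0 within {0..}.
          norm ((LINT x|\<nu> t. f x) - (LINT x|\<nu> t0. f x)) \<le> k * \<bar>?m t - ?m t0\<bar>"
        by (auto simp: eventually_at_filter)
    qed
    then show "((\<lambda>t. LINT x|\<nu> t. f x) \<longlongrightarrow> (LINT x|\<nu> t0. f x)) (at t0 within {0..})"
      by (rule LIM_zero_cancel)
  qed
qed

section \<open>Annulus integrals and the truncated drift\<close>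

text \<open>Two integrands matter: the identity, which occurs in \<open>M_fun\<close>, and
  \<open>abs\<close>, which controls how \<open>M_fun\<close> varies with the radius. Both satisfy
  the bound by \<open>\<bar>x\<bar>\<close> assumed below.\<close>

definition annulus_integral :: "real \<Rightarrow> (real \<Rightarrow> real) \<Rightarrow> real \<Rightarrow> real \<Rightarrow> real" where
  "annulus_integral t g a b = (LINT x:{x. a < \<bar>x\<bar> \<and> \<bar>x\<bar> \<le> b}|\<nu> t. g x)"

lemma annulus_bound:
  assumes "0 < a" and g: "\<And>x. \<bar>g x\<bar> \<le> \<bar>x\<bar>"
  shows "\<bar>indicator {x. a < \<bar>x\<bar> \<and> \<bar>x\<bar> \<le> b} x *\<^sub>R g x\<bar> \<le> (\<bar>b\<bar> * max 1 (1 / a\<^sup>2)) * levy_weight x"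
proof (cases "a < \<bar>x\<bar> \<and> \<bar>x\<bar> \<le> b")
  case True
  have "\<bar>g x\<bar> \<le> \<bar>b\<bar> * 1" using g[of x] True by auto
  also have "\<dots> \<le> \<bar>b\<bar> * (max 1 (1 / a\<^sup>2) * levy_weight x)"
    using True assms(1) by (intro mult_left_mono levy_weight_lower) auto
  finally show ?thesis using True by (simp add: mult.assoc)
qed auto

lemma annulus_integrable:
  assumes "0 \<le> t" "0 < a" "g \<in> borel_measurable borel" "\<And>x. \<bar>g x\<bar> \<le> \<bar>x\<bar>"
  shows "set_integrable (\<nu> t) {x. a < \<bar>x\<bar> \<and> \<bar>x\<bar> \<le> b} g"
  unfolding set_integrable_def
  by (rule integrable_\<nu>[OF assms(1) _ annulus_bound]) (use assms in auto)

lemma annulus_continuous_time: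
  assumes "0 < a" "g \<in> borel_measurable borel" "\<And>x. \<bar>g x\<bar> \<le> \<bar>x\<bar>"
  shows "continuous_on {0..} (\<lambda>t. annulus_integral t g a b)"
  unfolding annulus_integral_def set_lebesgue_integral_def
  by (rule integral_continuous_time[OF _ annulus_bound]) (use assms in auto)

lemma annulus_add:
  assumes "0 \<le> t" "0 < a" "a \<le> b" "b \<le> c" "g \<in> borel_measurable borel" "\<And>x. \<bar>g x\<bar> \<le> \<bar>x\<bar>"
  shows "annulus_integral t g a c = annulus_integral t g a b + annulus_integral t g b c"
proof -
  have "{x::real. a < \<bar>x\<bar> \<and> \<bar>x\<bar> \<le> c} = {x. a < \<bar>x\<bar> \<and> \<bar>x\<bar> \<le> b} \<union> {x. b < \<bar>x\<bar> \<and> \<bar>x\<bar> \<le> c}"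
    using assms by auto
  then show ?thesis unfolding annulus_integral_def
    using assms by (simp only:) (intro set_integral_Un annulus_integrable; auto)
qed

lemma annulus_abs_mono:
  assumes "0 \<le> s" "s \<le> t" "0 < a"
  shows "\<bar>annulus_integral s (\<lambda>x. x) a b\<bar> \<le> annulus_integral t abs a b"
proof -
  have "\<bar>annulus_integral s (\<lambda>x. x) a b\<bar> \<le> annulus_integral s abs a b"
    unfolding annulus_integral_def using set_integral_norm_bound[OF annulus_integrable[OF assms(1,3)]]
    by fastforce
  also have "\<dots> \<le> annulus_integral t abs a b"
    unfolding annulus_integral_def set_lebesgue_integral_def
  proof (rule integral_mono_time[OF assms(1,2)])
    show "indicator {x. a < \<bar>x\<bar> \<and> \<bar>x\<bar> \<le> b} x *\<^sub>R \<bar>x\<bar> \<le> (\<bar>b\<bar> * max 1 (1 / a\<^sup>2)) * levy_weight x" for x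
      using annulus_bound[OF assms(3), of abs b x] by auto
  qed auto
  finally show ?thesis .
qed

lemma annulus_abs_nonneg: "0 \<le> annulus_integral t abs a b"
  unfolding annulus_integral_def set_lebesgue_integral_def
  by (intro integral_nonneg_AE AE_I2) auto

text \<open>The truncation correction inside \<open>M_fun\<close>, seen as an oriented integral from
  radius 1 to radius \<open>r\<close>; one of the two annuli is always empty. Its increments are
  plain annulus integrals wherever 1 lies.\<close>

definition radial_primitive :: "real \<Rightarrow> (real \<Rightarrow> real) \<Rightarrow> real \<Rightarrow> real" where
  "radial_primitive t g r = annulus_integral t g 1 (max r 1) - annulus_integral t g (min r 1) 1"

lemma radial_primitive_diff:
  assumes t: "0 \<le> t" and r: "0 < r1" "r1 \<le> r2" and g: "g \<in> borel_measurable borel" "\<And>x. \<bar>g x\<bar> \<le> \<bar>x\<bar>"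
  shows "radial_primitive t g r2 - radial_primitive t g r1 = annulus_integral t g r1 r2"
proof -
  have empty: "annulus_integral t g a a = 0" if "0 < a" for a
    using annulus_add[OF t that order_refl order_refl g] by simp
  consider "r2 \<le> 1" | "r1 \<le> 1" "1 \<le> r2" | "1 \<le> r1" by linarith
  then show ?thesis
  proof cases
    case 1
    then show ?thesis using annulus_add[OF t r(1,2) 1 g] r empty
      by (simp add: radial_primitive_def)
  next
    case 2
    then show ?thesis using annulus_add[OF t r(1) 2 g] empty
      by (simp add: radial_primitive_def)
  next
    case 3
    then show ?thesis using annulus_add[OF t _ 3 r(2) g] r empty
      by (simp add: radial_primitive_def)
  qed
qed

lemma M_fun_eq: "M_fun B \<nu> t r = \<bar>B t + radial_primitive t (\<lambda>x. x) r\<bar> / r"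
  unfolding M_fun_def radial_primitive_def annulus_integral_def by (simp add: algebra_simps)

lemma M_fun_continuous_time:
  assumes "0 < r"
  shows "continuous_on {0..} (\<lambda>t. M_fun B \<nu> t r)"
  unfolding M_fun_eq radial_primitive_def
  using assms by (intro continuous_intros B_cont annulus_continuous_time) auto

lemma M_fun_bdd:
  assumes "0 < r"
  shows "bdd_above ((\<lambda>s. M_fun B \<nu> s r) ` {0..t})"
proof -
  have "compact ((\<lambda>s. M_fun B \<nu> s r) ` {0..t})"
    by (rule compact_continuous_image[OF continuous_on_subset[OF M_fun_continuous_time[OF assms]]]) auto
  then show ?thesis by (simp add: bounded_imp_bdd_above compact_imp_bounded)
qed

lemma M_fun_le_Mstar:
  assumes "0 < r" "0 \<le> s" "s \<le> t"
  shows "M_fun B \<nu> s r \<le> Mstar_fun B \<nu> t r"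
  unfolding Mstar_fun_def using assms by (intro cSUP_upper M_fun_bdd) auto

text \<open>Multiplication by \<open>r\<close> removes the prefactor, so at each time
  \<open>s \<le> t\<close> the change of \<open>r * M_fun\<close> is at most the annulus integral of
  \<open>abs\<close> under \<open>\<nu> s\<close>, hence under \<open>\<nu> t\<close>. A bound
  uniform in \<open>s\<close> passes to the supremum.\<close>

lemma Mstar_diff:
  assumes t: "0 \<le> t" and r: "0 < r1" "r1 \<le> r2"
  shows "\<bar>r2 * Mstar_fun B \<nu> t r2 - r1 * Mstar_fun B \<nu> t r1\<bar> \<le> annulus_integral t abs r1 r2"
proof -
  let ?V = "annulus_integral t abs r1 r2"
  have M: "\<bar>r2 * M_fun B \<nu> s r2 - r1 * M_fun B \<nu> s r1\<bar> \<le> ?V" if s: "0 \<le> s" "s \<le> t" for s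
  proof -
    have "\<bar>radial_primitive s (\<lambda>x. x) r2 - radial_primitive s (\<lambda>x. x) r1\<bar> \<le> ?V"
      using radial_primitive_diff[OF s(1) r, of "\<lambda>x. x"] annulus_abs_mono[OF s r(1)] by simp
    then show ?thesis using r unfolding M_fun_eq by simp
  qed
  have "Mstar_fun B \<nu> t r2 \<le> (r1 * Mstar_fun B \<nu> t r1 + ?V) / r2"
    unfolding Mstar_fun_def[of _ _ _ r2]
  proof (rule cSUP_least)
    fix s assume s: "s \<in> {0..t}"
    have "r1 * M_fun B \<nu> s r1 \<le> r1 * Mstar_fun B \<nu> t r1"
      using s r by (intro mult_left_mono M_fun_le_Mstar) auto
    moreover have "\<bar>r2 * M_fun B \<nu> s r2 - r1 * M_fun B \<nu> s r1\<bar> \<le> ?V" using M s by simp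
    ultimately have "r2 * M_fun B \<nu> s r2 \<le> r1 * Mstar_fun B \<nu> t r1 + ?V" by linarith
    then show "M_fun B \<nu> s r2 \<le> (r1 * Mstar_fun B \<nu> t r1 + ?V) / r2"
      using r by (simp add: pos_le_divide_eq mult.commute)
  qed (use t in auto)
  moreover have "Mstar_fun B \<nu> t r1 \<le> (r2 * Mstar_fun B \<nu> t r2 + ?V) / r1"
    unfolding Mstar_fun_def[of _ _ _ r1]
  proof (rule cSUP_least)
    fix s assume s: "s \<in> {0..t}"
    have "r2 * M_fun B \<nu> s r2 \<le> r2 * Mstar_fun B \<nu> t r2"
      using s r by (intro mult_left_mono M_fun_le_Mstar) auto
    moreover have "\<bar>r2 * M_fun B \<nu> s r2 - r1 * M_fun B \<nu> s r1\<bar> \<le> ?V" using M s by simp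
    ultimately have "r1 * M_fun B \<nu> s r1 \<le> r2 * Mstar_fun B \<nu> t r2 + ?V" by linarith
    then show "M_fun B \<nu> s r1 \<le> (r2 * Mstar_fun B \<nu> t r2 + ?V) / r1"
      using r by (simp add: pos_le_divide_eq mult.commute)
  qed (use t in auto)
  ultimately show ?thesis using r by (simp add: field_simps abs_le_iff)
qed

section \<open>Radial monotonicity of \<open>G_fun + K_fun\<close>\<close>

text \<open>The tail and the truncated second moment merge into one integrand, which decreases in
  \<open>r\<close> while its product with the square of \<open>r\<close> increases.
  \<open>GK_antimono\<close> and \<open>GK_scale\<close> read off these two facts.\<close>

lemma GK_eq:
  assumes t: "0 \<le> t" and r: "0 < r"
  shows "G_fun \<nu> t r + K_fun C \<nu> t r = C t / r\<^sup>2 + (LINT x|\<nu> t. min 1 (x\<^sup>2 / r\<^sup>2))"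
proof -
  let ?S = "\<lambda>x. indicator {x. \<bar>x\<bar> \<le> r} x *\<^sub>R x\<^sup>2"
  have Aint: "integrable (\<nu> t) (indicat_real {x. r < \<bar>x\<bar>})"
    by (rule integrable_\<nu>[OF t, where k = "max 1 (1 / r\<^sup>2)"])
       (use levy_weight_lower[OF r] in \<open>auto split: split_indicator\<close>)
  have Sint: "integrable (\<nu> t) ?S"
    by (rule integrable_\<nu>[OF t, where k = "max 1 (r\<^sup>2)"])
       (use levy_weight_upper in \<open>auto split: split_indicator\<close>)
  have "(LINT x|\<nu> t. min 1 (x\<^sup>2 / r\<^sup>2)) = (LINT x|\<nu> t. indicat_real {x. r < \<bar>x\<bar>} x + ?S x / r\<^sup>2)"
  proof (rule Bochner_Integration.integral_cong[OF refl])
    fix x :: real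
    show "min 1 (x\<^sup>2 / r\<^sup>2) = indicat_real {x. r < \<bar>x\<bar>} x + ?S x / r\<^sup>2"
    proof (cases "\<bar>x\<bar> \<le> r")
      case True
      then have "x\<^sup>2 \<le> r\<^sup>2" using r by (simp add: abs_le_square_iff[symmetric])
      then show ?thesis using True r by simp
    next
      case False
      then have "r\<^sup>2 \<le> x\<^sup>2" using r by (simp add: abs_le_square_iff[symmetric])
      then show ?thesis using False r by simp
    qed
  qed
  also have "\<dots> = G_fun \<nu> t r + (LINT x|\<nu> t. ?S x) / r\<^sup>2"
    using Aint Sint space_\<nu>[OF t] by (simp add: G_fun_def)
  finally show ?thesis by (simp add: K_fun_def set_lebesgue_integral_def add_divide_distrib)
qed

lemma C_nonneg: "0 \<le> t \<Longrightarrow> 0 \<le> C t"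
  using mono_onD[OF C_mono, of 0 t] C_0 by simp

lemma truncated_square_bound:
  fixes x r :: real
  assumes "0 < r"
  shows "min 1 (x\<^sup>2 / r\<^sup>2) \<le> max 1 (1 / r\<^sup>2) * levy_weight x"
proof (cases "x\<^sup>2 \<le> 1")
  case True
  have "x\<^sup>2 / r\<^sup>2 = 1 / r\<^sup>2 * x\<^sup>2" by simp
  also have "\<dots> \<le> max 1 (1 / r\<^sup>2) * x\<^sup>2" by (intro mult_right_mono) auto
  finally show ?thesis using True by simp
qed auto

lemma truncated_square_integrable:
  assumes t: "0 \<le> t" and r: "0 < r"
  shows "integrable (\<nu> t) (\<lambda>x. min 1 (x\<^sup>2 / r\<^sup>2))"
  by (rule integrable_\<nu>[OF t, where k = "max 1 (1 / r\<^sup>2)"])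
     (use truncated_square_bound[OF r] in auto)

lemma GK_antimono:
  assumes t: "0 \<le> t" and r: "0 < r1" "r1 \<le> r2"
  shows "G_fun \<nu> t r2 + K_fun C \<nu> t r2 \<le> G_fun \<nu> t r1 + K_fun C \<nu> t r1"
proof -
  have sq: "r1\<^sup>2 \<le> r2\<^sup>2" "0 < r1\<^sup>2" "0 < r2\<^sup>2" using r by (auto intro: power_mono)
  have "(LINT x|\<nu> t. min 1 (x\<^sup>2 / r2\<^sup>2)) \<le> (LINT x|\<nu> t. min 1 (x\<^sup>2 / r1\<^sup>2))"
    using r t sq by (intro integral_mono truncated_square_integrable min.mono divide_left_mono) auto
  moreover have "C t / r2\<^sup>2 \<le> C t / r1\<^sup>2"
    using sq C_nonneg[OF t] by (intro divide_left_mono mult_pos_pos)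
  ultimately show ?thesis using r t by (simp add: GK_eq)
qed

lemma GK_scale:
  assumes t: "0 \<le> t" and r: "0 < r1" "r1 \<le> r2"
  shows "G_fun \<nu> t r1 + K_fun C \<nu> t r1 \<le> (r2 / r1)\<^sup>2 * (G_fun \<nu> t r2 + K_fun C \<nu> t r2)"
proof -
  have q: "1 \<le> (r2 / r1)\<^sup>2" using r by (intro one_le_power) auto
  have "(LINT x|\<nu> t. min 1 (x\<^sup>2 / r1\<^sup>2)) \<le> (LINT x|\<nu> t. (r2 / r1)\<^sup>2 * min 1 (x\<^sup>2 / r2\<^sup>2))"
  proof (rule integral_mono)
    fix x :: real
    have "(r2 / r1)\<^sup>2 * min 1 (x\<^sup>2 / r2\<^sup>2) = min ((r2 / r1)\<^sup>2) (x\<^sup>2 / r1\<^sup>2)"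
      using r by (subst min_mult_distrib_left) (auto simp: power_divide)
    then show "min 1 (x\<^sup>2 / r1\<^sup>2) \<le> (r2 / r1)\<^sup>2 * min 1 (x\<^sup>2 / r2\<^sup>2)"
      using q by auto
  qed (use r t truncated_square_integrable in auto)
  moreover have "C t / r1\<^sup>2 = (r2 / r1)\<^sup>2 * (C t / r2\<^sup>2)"
    using r by (simp add: power_divide)
  ultimately show ?thesis using r t by (simp add: GK_eq algebra_simps)
qed

lemma G_fun_nonneg: "0 \<le> G_fun \<nu> t r"
  by (simp add: G_fun_def)

lemma K_fun_nonneg: "0 \<le> t \<Longrightarrow> 0 \<le> K_fun C \<nu> t r"
  unfolding K_fun_def set_lebesgue_integral_def
  by (intro divide_nonneg_nonneg add_nonneg_nonneg C_nonneg integral_nonneg_AE AE_I2) auto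

lemma Mstar_fun_nonneg:
  assumes "0 \<le> t" "0 < r"
  shows "0 \<le> Mstar_fun B \<nu> t r"
proof -
  have "0 \<le> M_fun B \<nu> t r" using assms by (simp add: M_fun_eq)
  also have "\<dots> \<le> Mstar_fun B \<nu> t r" using assms by (intro M_fun_le_Mstar) auto
  finally show ?thesis .
qed

text \<open>On the annulus \<open>\<bar>x\<bar> \<le> r2\<close>, which leaves a tail at the inner
  radius. Its companion \<open>annulus_abs_le_K\<close> uses
  \<open>\<bar>x\<bar> \<le> x\<^sup>2 / r1\<close> and leaves a second moment at the outer radius.
  Two versions are required because each comparison of \<open>y_comp\<close> at two radii must have
  all its error terms at the radius on its right-hand side.\<close>

lemma annulus_abs_le_G:
  assumes t: "0 \<le> t" and r: "0 < r1"
  shows "annulus_integral t abs r1 r2 \<le> \<bar>r2\<bar> * G_fun \<nu> t r1"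
proof -
  have Aint: "integrable (\<nu> t) (indicat_real {x. r1 < \<bar>x\<bar>})"
    by (rule integrable_\<nu>[OF t, where k = "max 1 (1 / r1\<^sup>2)"])
       (use levy_weight_lower[OF r] in \<open>auto split: split_indicator\<close>)
  have "annulus_integral t abs r1 r2 \<le> (LINT x|\<nu> t. \<bar>r2\<bar> * indicat_real {x. r1 < \<bar>x\<bar>} x)"
    unfolding annulus_integral_def set_lebesgue_integral_def
  proof (rule integral_mono)
    show "integrable (\<nu> t) (\<lambda>x. indicat_real {x. r1 < \<bar>x\<bar> \<and> \<bar>x\<bar> \<le> r2} x *\<^sub>R \<bar>x\<bar>)"
      using annulus_integrable[OF t r, of abs r2] by (simp add: set_integrable_def)
  qed (use Aint in \<open>auto split: split_indicator\<close>)
  then show ?thesis using space_\<nu>[OF t] by (simp add: G_fun_def)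
qed

lemma annulus_abs_le_K:
  assumes t: "0 \<le> t" and r: "0 < r1" "r1 \<le> r2"
  shows "annulus_integral t abs r1 r2 \<le> r2\<^sup>2 / r1 * K_fun C \<nu> t r2"
proof -
  let ?S = "\<lambda>x. indicator {x. \<bar>x\<bar> \<le> r2} x *\<^sub>R x\<^sup>2"
  have Sint: "integrable (\<nu> t) ?S"
    by (rule integrable_\<nu>[OF t, where k = "max 1 (r2\<^sup>2)"])
       (use levy_weight_upper in \<open>auto split: split_indicator\<close>)
  have "annulus_integral t abs r1 r2 \<le> (LINT x|\<nu> t. ?S x / r1)"
    unfolding annulus_integral_def set_lebesgue_integral_def
  proof (rule integral_mono)
    show "integrable (\<nu> t) (\<lambda>x. indicat_real {x. r1 < \<bar>x\<bar> \<and> \<bar>x\<bar> \<le> r2} x *\<^sub>R \<bar>x\<bar>)"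
      using annulus_integrable[OF t r(1), of abs r2] by (simp add: set_integrable_def)
    fix x :: real
    show "indicat_real {x. r1 < \<bar>x\<bar> \<and> \<bar>x\<bar> \<le> r2} x *\<^sub>R \<bar>x\<bar> \<le> ?S x / r1"
    proof (cases "r1 < \<bar>x\<bar> \<and> \<bar>x\<bar> \<le> r2")
      case True
      then have "\<bar>x\<bar> * r1 \<le> \<bar>x\<bar> * \<bar>x\<bar>" using r by (intro mult_left_mono) auto
      then show ?thesis using True r by (simp add: field_simps power2_eq_square)
    qed (use r in auto)
  qed (use Sint in auto)
  also have "\<dots> \<le> (C t + (LINT x|\<nu> t. ?S x)) / r1"
    using C_nonneg[OF t] r by (simp add: divide_right_mono)
  also have "\<dots> = r2\<^sup>2 / r1 * K_fun C \<nu> t r2"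
    using r by (simp add: K_fun_def set_lebesgue_integral_def)
  finally show ?thesis .
qed

section \<open>Regularity of \<open>y_comp\<close> in radius and time\<close>

lemma y_comp_nonneg: "0 \<le> t \<Longrightarrow> 0 < r \<Longrightarrow> 0 \<le> y_comp B C \<nu> t r"
  unfolding y_comp_def by (intro add_nonneg_nonneg G_fun_nonneg K_fun_nonneg Mstar_fun_nonneg)

text \<open>The drift term at \<open>r2\<close> costs the drift term at \<open>r1\<close> plus one
  extra \<open>G_fun \<nu> t r1\<close>. That tail is then counted twice, whence the factor
  2.\<close>

lemma y_comp_quasi_antimono:
  assumes t: "0 \<le> t" and r: "0 < r1" "r1 \<le> r2"
  shows "y_comp B C \<nu> t r2 \<le> 2 * y_comp B C \<nu> t r1"
proof -
  let ?M = "Mstar_fun B \<nu> t"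
  have "r2 * ?M r2 \<le> r1 * ?M r1 + r2 * G_fun \<nu> t r1"
    using Mstar_diff[OF t r] annulus_abs_le_G[OF t r(1), of r2] r by auto
  also have "\<dots> \<le> r2 * ?M r1 + r2 * G_fun \<nu> t r1"
    using r t by (intro add_right_mono mult_right_mono Mstar_fun_nonneg) auto
  finally have "r2 * ?M r2 \<le> r2 * (?M r1 + G_fun \<nu> t r1)" by (simp add: algebra_simps)
  then have "?M r2 \<le> ?M r1 + G_fun \<nu> t r1" using r by simp
  then show ?thesis
    using GK_antimono[OF t r] G_fun_nonneg[of t r1] K_fun_nonneg[OF t, of r1] Mstar_fun_nonneg[OF t r(1)]
    unfolding y_comp_def by (simp add: algebra_simps)
qed

text \<open>Here the drift term costs an extra \<open>K_fun C \<nu> t r2\<close>, again counted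
  twice. The drift itself scales by \<open>r2 / r1\<close> only, which is at most its
  square.\<close>

lemma y_comp_scale:
  assumes t: "0 \<le> t" and r: "0 < r1" "r1 \<le> r2"
  shows "y_comp B C \<nu> t r1 \<le> 2 * (r2 / r1)\<^sup>2 * y_comp B C \<nu> t r2"
proof -
  let ?M = "Mstar_fun B \<nu> t"
  let ?q = "(r2 / r1)\<^sup>2"
  have q: "r2 / r1 \<le> ?q" "0 \<le> ?q" using r by (auto intro!: self_le_power)
  have "r1 * ?M r1 \<le> r2 * ?M r2 + r2\<^sup>2 / r1 * K_fun C \<nu> t r2"
    using Mstar_diff[OF t r] annulus_abs_le_K[OF t r] by auto
  then have "?M r1 \<le> (r2 * ?M r2 + r2\<^sup>2 / r1 * K_fun C \<nu> t r2) / r1"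
    using r by (simp add: pos_le_divide_eq mult.commute)
  also have "\<dots> = r2 / r1 * ?M r2 + ?q * K_fun C \<nu> t r2"
    using r by (simp add: add_divide_distrib power_divide power2_eq_square)
  also have "\<dots> \<le> ?q * ?M r2 + ?q * K_fun C \<nu> t r2"
    using q r t by (intro add_right_mono mult_right_mono Mstar_fun_nonneg) auto
  finally have M: "?M r1 \<le> ?q * ?M r2 + ?q * K_fun C \<nu> t r2" .
  have "0 \<le> ?q * G_fun \<nu> t r2" "0 \<le> ?q * ?M r2"
    using q r t by (intro mult_nonneg_nonneg G_fun_nonneg Mstar_fun_nonneg; simp)+
  with M GK_scale[OF t r] show ?thesis
    unfolding y_comp_def by (simp add: algebra_simps)
qed

text \<open>By \<open>Mstar_diff\<close>, \<open>r * Mstar_fun B \<nu> t r\<close> is a difference of two increasing functions of \<open>r\<close>.\<close>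

lemma y_comp_measurable:
  assumes t: "0 \<le> t"
  shows "(\<lambda>r. y_comp B C \<nu> t r) \<in> borel_measurable (restrict_space borel {0<..})"
proof -
  let ?R = "restrict_space borel {0<..} :: real measure"
  let ?W = "radial_primitive t abs"
  have "(\<lambda>r. - (G_fun \<nu> t r + K_fun C \<nu> t r)) \<in> borel_measurable ?R"
    by (intro borel_measurable_mono_on_fnc mono_onI le_imp_neg_le GK_antimono[OF t]) auto
  from borel_measurable_uminus[OF this]
  have GK: "(\<lambda>r. G_fun \<nu> t r + K_fun C \<nu> t r) \<in> borel_measurable ?R"
    unfolding minus_minus .
  have Wdiff: "?W r2 - ?W r1 = annulus_integral t abs r1 r2" if "0 < r1" "r1 \<le> r2" for r1 r2
    by (rule radial_primitive_diff[OF t that]) auto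
  have W: "?W \<in> borel_measurable ?R"
  proof (intro borel_measurable_mono_on_fnc mono_onI)
    fix r1 r2 :: real assume "r1 \<in> {0<..}" "r1 \<le> r2"
    then show "?W r1 \<le> ?W r2" using Wdiff[of r1 r2] annulus_abs_nonneg[of t r1 r2] by auto
  qed
  have "(\<lambda>r. r * Mstar_fun B \<nu> t r + ?W r) \<in> borel_measurable ?R"
  proof (intro borel_measurable_mono_on_fnc mono_onI)
    fix r1 r2 :: real assume "r1 \<in> {0<..}" "r1 \<le> r2"
    then show "r1 * Mstar_fun B \<nu> t r1 + ?W r1 \<le> r2 * Mstar_fun B \<nu> t r2 + ?W r2"
      using Wdiff[of r1 r2] Mstar_diff[OF t, of r1 r2] by auto
  qed
  moreover have "(\<lambda>r. r) \<in> borel_measurable ?R" by (intro measurable_restrict_space1) measurable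
  ultimately have M: "(\<lambda>r. ((r * Mstar_fun B \<nu> t r + ?W r) - ?W r) / r) \<in> borel_measurable ?R"
    using W by (intro borel_measurable_divide borel_measurable_diff)
  have "(\<lambda>r. (G_fun \<nu> t r + K_fun C \<nu> t r) + ((r * Mstar_fun B \<nu> t r + ?W r) - ?W r) / r)
      \<in> borel_measurable ?R"
    by (intro borel_measurable_add GK M)
  then show ?thesis
    by (rule measurable_cong[THEN iffD1, rotated]) (auto simp: y_comp_def space_restrict_space)
qed

lemma y_comp_continuous_time:
  assumes r: "0 < r"
  shows "continuous_on {0..} (\<lambda>t. y_comp B C \<nu> t r)"
proof -
  have "continuous_on {0..} (\<lambda>t. Mstar_fun B \<nu> t r)"
    unfolding Mstar_fun_def by (intro continuous_on_running_Sup M_fun_continuous_time r)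
  moreover have "continuous_on {0..} (\<lambda>t. C t / r\<^sup>2 + (LINT x|\<nu> t. min 1 (x\<^sup>2 / r\<^sup>2)))"
  proof (intro continuous_intros C_cont)
    show "continuous_on {0..} (\<lambda>t. LINT x|\<nu> t. min 1 (x\<^sup>2 / r\<^sup>2))"
      by (rule integral_continuous_time[where k = "max 1 (1 / r\<^sup>2)"])
         (use truncated_square_bound[OF r] in auto)
  qed (use r in auto)
  ultimately have "continuous_on {0..}
      (\<lambda>t. C t / r\<^sup>2 + (LINT x|\<nu> t. min 1 (x\<^sup>2 / r\<^sup>2)) + Mstar_fun B \<nu> t r)"
    by (rule continuous_on_add[rotated])
  then show ?thesis
    by (rule continuous_on_cong[THEN iffD1, rotated 2]) (use r in \<open>auto simp: y_comp_def GK_eq\<close>)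
qed

end

text \<open>The rest of the proof uses \<open>y\<close> through these five properties. The
  inequalities are linear in \<open>y s\<close> with constants common to all components, so they
  pass unchanged to the sum over the coordinates.\<close>

locale quasi_decreasing =
  fixes y :: "real \<Rightarrow> real \<Rightarrow> real"
  assumes nonneg: "\<And>s r. 0 \<le> s \<Longrightarrow> 0 < r \<Longrightarrow> 0 \<le> y s r"
    and quasi_antimono: "\<And>s r1 r2. 0 \<le> s \<Longrightarrow> 0 < r1 \<Longrightarrow> r1 \<le> r2 \<Longrightarrow> y s r2 \<le> 2 * y s r1"
    and scale: "\<And>s r1 r2. 0 \<le> s \<Longrightarrow> 0 < r1 \<Longrightarrow> r1 \<le> r2 \<Longrightarrow> y s r1 \<le> 2 * (r2 / r1)\<^sup>2 * y s r2"
    and measurable_radius: "\<And>s. 0 \<le> s \<Longrightarrow> y s \<in> borel_measurable (restrict_space borel {0<..})"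
    and continuous_time: "\<And>r. 0 < r \<Longrightarrow> continuous_on {0..} (\<lambda>s. y s r)"

lemma has_characteristics_imp_characteristics:
  assumes "has_characteristics M X B C \<nu>"
  shows "characteristics B C \<nu>"
  using assms unfolding has_characteristics_def by unfold_locales blast+

lemma quasi_decreasing_y_fun:
  assumes "\<And>i. characteristics (B i) (C i) (\<nu> i)"
  shows "quasi_decreasing (y_fun B C \<nu>)"
proof
  fix s r :: real assume "0 \<le> s" "0 < r"
  then show "0 \<le> y_fun B C \<nu> s r"
    unfolding y_fun_def by (intro sum_nonneg characteristics.y_comp_nonneg assms)
next
  fix s r1 r2 :: real assume "0 \<le> s" "0 < r1" "r1 \<le> r2"
  then show "y_fun B C \<nu> s r2 \<le> 2 * y_fun B C \<nu> s r1"
    unfolding y_fun_def sum_distrib_left by (intro sum_mono characteristics.y_comp_quasi_antimono assms)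
next
  fix s r1 r2 :: real assume "0 \<le> s" "0 < r1" "r1 \<le> r2"
  then show "y_fun B C \<nu> s r1 \<le> 2 * (r2 / r1)\<^sup>2 * y_fun B C \<nu> s r2"
    unfolding y_fun_def sum_distrib_left by (intro sum_mono characteristics.y_comp_scale assms)
next
  fix s :: real assume "0 \<le> s"
  then show "y_fun B C \<nu> s \<in> borel_measurable (restrict_space borel {0<..})"
    unfolding y_fun_def by (intro borel_measurable_sum characteristics.y_comp_measurable assms)
next
  fix r :: real assume "0 < r"
  then show "continuous_on {0..} (\<lambda>s. y_fun B C \<nu> s r)"
    unfolding y_fun_def by (intro continuous_on_sum characteristics.y_comp_continuous_time assms)
qed

section \<open>The averaged function \<open>ydot\<close>\<close>

text \<open>Cut the interval into \<open>Suc n\<close> equal pieces: the quadratic errors add up to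
  a multiple of \<open>1 / Suc n\<close>, which tends to 0. This stands in for the rule that a
  nonpositive derivative makes a function decrease.\<close>

lemma quadratic_increment_imp_le:
  fixes D :: "real \<Rightarrow> real"
  assumes ab: "a \<le> b" and D: "\<And>x y. a \<le> x \<Longrightarrow> x \<le> y \<Longrightarrow> y \<le> b \<Longrightarrow> D y - D x \<le> L * (y - x)\<^sup>2"
  shows "D b \<le> D a"
proof -
  have bound: "D b - D a \<le> L * (b - a)\<^sup>2 * inverse (real (Suc n))" for n
  proof -
    define h where "h = (b - a) / real (Suc n)"
    have h: "0 \<le> h" "real (Suc n) * h = b - a" using ab by (auto simp: h_def simp del: of_nat_Suc)
    have "D (a + real k * h) - D a \<le> real k * (L * h\<^sup>2)" if "k \<le> Suc n" for k
      using that
    proof (induction k)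
      case (Suc k)
      have "real (Suc k) * h \<le> real (Suc n) * h" using Suc.prems h(1) by (intro mult_right_mono) auto
      then have "a + real (Suc k) * h \<le> b" using h(2) by linarith
      then have "D (a + real (Suc k) * h) - D (a + real k * h)
          \<le> L * ((a + real (Suc k) * h) - (a + real k * h))\<^sup>2"
        using h(1) by (intro D) (auto intro: mult_right_mono)
      moreover have "(a + real (Suc k) * h) - (a + real k * h) = h" by (simp add: algebra_simps)
      ultimately show ?case using Suc by (simp add: algebra_simps)
    qed simp
    from this[of "Suc n"] have "D b - D a \<le> real (Suc n) * (L * h\<^sup>2)"
      using h(2) by (simp del: of_nat_Suc)
    also have "\<dots> = L * (b - a)\<^sup>2 * inverse (real (Suc n))"
      by (simp add: h_def power2_eq_square field_simps del: of_nat_Suc)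
    finally show ?thesis .
  qed
  have "(\<lambda>n. L * (b - a)\<^sup>2 * inverse (real (Suc n))) \<longlonglongrightarrow> L * (b - a)\<^sup>2 * 0"
    by (intro tendsto_mult_left LIMSEQ_inverse_real_of_nat)
  then have "D b - D a \<le> L * (b - a)\<^sup>2 * 0"
    by (rule Lim_bounded2) (use bound in auto)
  then show ?thesis by simp
qed

lemma ln_diff_le_left:
  fixes p q :: real
  assumes "0 < p" "0 < q"
  shows "ln q - ln p \<le> (q - p) / p"
  using ln_le_minus_one[of "q / p"] assms by (simp add: ln_div diff_divide_distrib)

lemma ln_diff_ge_right:
  fixes p q :: real
  assumes "0 < p" "0 < q"
  shows "(q - p) / q \<le> ln q - ln p"
  using ln_diff_le_left[OF assms(2,1)] by (simp add: diff_divide_distrib)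

lemma set_integrable_const_Ioc:
  fixes x y q :: real
  shows "set_integrable lborel {x<..y} (\<lambda>_. q)"
  unfolding set_integrable_def
  by (intro integrable_scaleR_left integrable_real_indicator emeasure_bounded_finite)
     (auto simp: bounded_Ioc)

text \<open>Formally one integrates \<open>(ln F)' = f / F\<close>; as \<open>F\<close> is differentiable only almost everywhere,
  increments over short intervals are compared instead, with a quadratic error.\<close>

lemma ln_primitive_comparison:
  fixes f g :: "real \<Rightarrow> real"
  defines "F \<equiv> \<lambda>r. LINT x:{0<..r}|lborel. f x" and "G \<equiv> \<lambda>r. LINT x:{0<..r}|lborel. g x"
  assumes ab: "0 < a" "a \<le> b" and l: "0 \<le> l"
    and f_int: "set_integrable lborel {0<..b} f" and g_int: "set_integrable lborel {0<..b} g"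
    and f: "\<And>x. 0 < x \<Longrightarrow> x \<le> b \<Longrightarrow> 0 \<le> f x \<and> f x \<le> k"
    and g: "\<And>x. 0 < x \<Longrightarrow> x \<le> b \<Longrightarrow> 0 \<le> g x \<and> g x \<le> k"
    and pos: "0 < F a" "0 < G a"
    and le: "\<And>x. a \<le> x \<Longrightarrow> x \<le> b \<Longrightarrow> f x / F x \<le> g x / G x + l / x + c"
  shows "ln (F b) - ln (F a) \<le> ln (G b) - ln (G a) + l * (ln b - ln a) + c * (b - a)"
proof -
  have sub: "set_integrable lborel {x<..y} h" if "set_integrable lborel {0<..b} h" "0 \<le> x" "y \<le> b"
    for x y and h :: "real \<Rightarrow> real"
    by (rule set_integrable_subset[OF that(1)]) (use that(2,3) in auto)
  note const = set_integrable_const_Ioc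
  have const_int: "(LINT u:{x<..y}|lborel. q) = q * (y - x)" if "x \<le> y" for x y q :: real
    using that by (simp add: set_lebesgue_integral_def)
  have inc: "(LINT x:{0<..y}|lborel. h x) - (LINT x:{0<..x}|lborel. h x) = (LINT u:{x<..y}|lborel. h u)"
    if "set_integrable lborel {0<..b} h" "0 < x" "x \<le> y" "y \<le> b" for x y and h :: "real \<Rightarrow> real"
  proof -
    have "{0<..y} = {0<..x} \<union> {x<..y}" using that(2,3) by auto
    moreover have "(LINT u:{0<..x} \<union> {x<..y}|lborel. h u)
        = (LINT u:{0<..x}|lborel. h u) + (LINT u:{x<..y}|lborel. h u)"
      by (intro set_integral_Un sub[OF that(1)]) (use that(2-4) in auto)
    ultimately show ?thesis by simp
  qed
  have inc_bounds: "0 \<le> (LINT u:{x<..y}|lborel. h u) \<and> (LINT u:{x<..y}|lborel. h u) \<le> k * (y - x)"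
    if h: "set_integrable lborel {0<..b} h" "\<And>x. 0 < x \<Longrightarrow> x \<le> b \<Longrightarrow> 0 \<le> h x \<and> h x \<le> k"
      and xy: "0 < x" "x \<le> y" "y \<le> b" for x y and h :: "real \<Rightarrow> real"
  proof
    show "0 \<le> (LINT u:{x<..y}|lborel. h u)"
      unfolding set_lebesgue_integral_def
      by (intro integral_nonneg_AE AE_I2) (use h(2) xy in \<open>auto split: split_indicator\<close>)
    have "(LINT u:{x<..y}|lborel. h u) \<le> (LINT u:{x<..y}|lborel. k)"
      by (intro set_integral_mono sub[OF h(1)] const) (use h(2) xy in auto)
    then show "(LINT u:{x<..y}|lborel. h u) \<le> k * (y - x)" using const_int xy by simp
  qed
  have mono: "F x \<le> F y \<and> F y \<le> F x + k * (y - x) \<and> G x \<le> G y \<and> G y \<le> G x + k * (y - x)"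
    if "0 < x" "x \<le> y" "y \<le> b" for x y
    using inc_bounds[OF f_int f that] inc_bounds[OF g_int g that] inc[OF f_int that] inc[OF g_int that]
    unfolding F_def G_def by linarith
  have k: "0 \<le> k" using f[of b] ab by linarith
  \<comment> \<open>One term for each quantity frozen at an endpoint of a short interval:
    \<open>F\<close> at the left end, \<open>G\<close> and \<open>l / u\<close> at the right end.
    Since \<open>k\<close> bounds the integrands, it is also a Lipschitz constant of
    \<open>F\<close> and \<open>G\<close>.\<close>
  define L where "L = k\<^sup>2 / (F a)\<^sup>2 + k\<^sup>2 / (G a)\<^sup>2 + l / a\<^sup>2"
  \<comment> \<open>The cost of enlarging a denominator from \<open>p\<close> to \<open>p'\<close>
    by at most \<open>k * d\<close>.\<close>
  have recip: "q / p \<le> q / p' + k\<^sup>2 / p0\<^sup>2 * d"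
    if "0 < p0" "p0 \<le> p" "p \<le> p'" "p' \<le> p + k * d" "0 \<le> q" "q \<le> k" "0 \<le> d" for p p' p0 q d
  proof -
    have "q / p - q / p' = q * (p' - p) / (p * p')" using that by (simp add: field_simps)
    also have "\<dots> \<le> k * (k * d) / (p0 * p0)"
      using that k by (intro frac_le mult_mono) auto
    also have "\<dots> = k\<^sup>2 / p0\<^sup>2 * d" by (simp add: power2_eq_square)
    finally show ?thesis by simp
  qed
  define D where "D x = ln (F x) - ln (G x) - l * ln x - c * x" for x
  have "D b \<le> D a"
  proof (rule quadratic_increment_imp_le[OF ab(2)])
    fix x y assume xy: "a \<le> x" "x \<le> y" "y \<le> b"
    have x0: "0 < x" "0 < y" using xy ab by linarith+
    have Fx: "F a \<le> F x" "F x \<le> F y" "G a \<le> G x" "G x \<le> G y"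
      using mono[of a x] mono[of x y] xy ab by auto
    have fi: "set_integrable lborel {x<..y} (\<lambda>u. f u / F x)"
      using x0 xy by (intro set_integrable_divide sub[OF f_int]) auto
    have gi: "set_integrable lborel {x<..y} (\<lambda>u. g u / G y)"
      using x0 xy by (intro set_integrable_divide sub[OF g_int]) auto
    \<comment> \<open>Concavity of the logarithm with opposite endpoints: an upper bound with
      denominator \<open>F x\<close> for \<open>F\<close>, lower bounds with denominators
      \<open>G y\<close> and \<open>y\<close> for the terms that enter \<open>D\<close> negatively.
      Afterwards both increments are integrals over the same short interval, and the hypothesis can
      be used pointwise.\<close>
    have "ln (F y) - ln (F x) \<le> (F y - F x) / F x"
      using Fx pos by (intro ln_diff_le_left) auto
    moreover have "(G y - G x) / G y \<le> ln (G y) - ln (G x)"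
      using Fx pos by (intro ln_diff_ge_right) auto
    moreover have "l * ((y - x) / y) \<le> l * (ln y - ln x)"
      using x0 l by (intro mult_left_mono ln_diff_ge_right) auto
    ultimately have "D y - D x
        \<le> (F y - F x) / F x - (G y - G x) / G y - l * ((y - x) / y) - c * (y - x)"
      unfolding D_def by (simp add: algebra_simps)
    also have "\<dots> = (LINT u:{x<..y}|lborel. f u / F x) - (LINT u:{x<..y}|lborel. g u / G y)
        - (LINT u:{x<..y}|lborel. l / y + c)"
      using inc[OF f_int x0(1) xy(2,3)] inc[OF g_int x0(1) xy(2,3)]
        const_int[OF xy(2), of "l / y + c"]
      unfolding F_def G_def by (simp add: left_diff_distrib distrib_right)
    also have "\<dots> = (LINT u:{x<..y}|lborel. f u / F x - g u / G y - (l / y + c))"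
      by (simp only: set_integral_diff(2)[OF set_integral_diff(1)[OF fi gi] const] set_integral_diff(2)[OF fi gi])
    also have "\<dots> \<le> (LINT u:{x<..y}|lborel. L * (y - x))"
    proof (rule set_integral_mono)
      show "set_integrable lborel {x<..y} (\<lambda>u. f u / F x - g u / G y - (l / y + c))"
        by (intro set_integral_diff(1) fi gi const)
      fix u assume u: "u \<in> {x<..y}"
      have "f u / F x \<le> f u / F u + k\<^sup>2 / (F a)\<^sup>2 * (y - x)"
      proof (rule recip)
        have "k * (u - x) \<le> k * (y - x)" using u k by (intro mult_left_mono) auto
        then show "F u \<le> F x + k * (y - x)" using mono[of x u] u xy x0 by auto
      qed (use mono[of x u] Fx pos f[of u] u xy x0 in auto)
      moreover have "g u / G u \<le> g u / G y + k\<^sup>2 / (G a)\<^sup>2 * (y - x)"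
      proof (rule recip)
        have "k * (y - u) \<le> k * (y - x)" using u k by (intro mult_left_mono) auto
        then show "G y \<le> G u + k * (y - x)" using mono[of u y] u xy x0 by auto
      qed (use mono[of u y] mono[of a u] Fx pos g[of u] u xy x0 ab in auto)
      moreover have "l / u \<le> l / y + l / a\<^sup>2 * (y - x)"
      proof -
        have "l / u - l / y = l * (y - u) / (u * y)" using u x0 by (simp add: field_simps)
        also have "\<dots> \<le> l * (y - x) / (a * a)"
          using u xy ab l by (intro frac_le mult_mono) auto
        finally show ?thesis by (simp add: power2_eq_square)
      qed
      moreover have "f u / F u \<le> g u / G u + l / u + c" using u xy by (intro le) auto
      ultimately show "f u / F x - g u / G y - (l / y + c) \<le> L * (y - x)"
        unfolding L_def by (simp add: algebra_simps)
    qed (rule const)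
    also have "\<dots> = L * (y - x)\<^sup>2" using const_int[OF xy(2)] by (simp add: power2_eq_square)
    finally show "D y - D x \<le> L * (y - x)\<^sup>2" .
  qed
  then show ?thesis unfolding D_def by (simp add: algebra_simps)
qed

text \<open>Slowness makes \<open>ln (c u) / ln u\<close> small as \<open>u\<close> tends to 0. Away
  from 0 the quotient is bounded and goes into \<open>k\<close>. Integrated,
  \<open>h / u + k\<close> gives a power with exponent as small as desired, times a bounded
  factor.\<close>

lemma slow_log_quotient:
  assumes c: "continuous_slow c" and h: "0 < h"
  obtains k where "0 \<le> k" "\<And>u. 0 < u \<Longrightarrow> u \<le> 1/2 \<Longrightarrow> ln (c u) / ln u / u \<le> h / u + k"
proof -
  obtain A where A: "0 < A" "\<And>r. 0 < r \<Longrightarrow> r \<le> 1/2 \<Longrightarrow> A * r powr (h/2) \<le> c r"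
    using continuous_slow_lower[OF c, of "h/2" "1/2"] h by auto
  \<comment> \<open>For \<open>u \<le> r\<close> the term \<open>\<bar>ln A\<bar> / w\<close> is at
    most \<open>h/2\<close>. For larger \<open>u\<close>, the bounds \<open>ln 2 \<le> w\<close> and
    \<open>r < u\<close> give the value of \<open>k\<close>; \<open>u \<le> 1/2\<close> is what
    keeps \<open>w\<close> away from 0.\<close>
  define r where "r = exp (- 2 * \<bar>ln A\<bar> / h)"
  define k where "k = \<bar>ln A\<bar> / (ln 2 * r)"
  have r: "0 < r" by (simp add: r_def)
  show ?thesis
  proof (rule that)
    show "0 \<le> k" using r by (simp add: k_def)
    fix u :: real assume u: "0 < u" "u \<le> 1/2"
    have "ln u \<le> ln (1/2)" using u by simp
    define w where "w = - ln u"
    have "ln (1/2) = - ln (2::real)" by (simp add: ln_div)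
    moreover have "0 < ln (2::real)" by simp
    ultimately have w: "ln 2 \<le> w" "0 < w" using \<open>ln u \<le> ln (1/2)\<close> unfolding w_def by linarith+
    have "ln (A * u powr (h/2)) \<le> ln (c u)"
      using A(2)[OF u] A(1) u continuous_slow_bounds[OF c, of u] by simp
    then have low: "- ln (c u) \<le> \<bar>ln A\<bar> + h/2 * w" using A(1) u by (simp add: ln_mult ln_powr w_def)
    have "ln (c u) / ln u = - ln (c u) / w" by (simp add: w_def)
    also have "\<dots> \<le> (\<bar>ln A\<bar> + h/2 * w) / w" by (rule divide_right_mono[OF low]) (use w in auto)
    also have "\<dots> = \<bar>ln A\<bar> / w + h/2" using w by (simp add: add_divide_distrib)
    finally have main: "ln (c u) / ln u \<le> \<bar>ln A\<bar> / w + h/2" .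
    show "ln (c u) / ln u / u \<le> h / u + k"
    proof (cases "u \<le> r")
      case True
      have "ln u \<le> ln r" using True u by simp
      then have "2 * \<bar>ln A\<bar> / h \<le> w" by (simp add: r_def w_def)
      then have "2 * \<bar>ln A\<bar> \<le> w * h" using h by (simp add: pos_divide_le_eq)
      then have "\<bar>ln A\<bar> / w \<le> h/2" using w by (simp add: pos_divide_le_eq mult.commute)
      then have "ln (c u) / ln u \<le> h" using main by linarith
      then have "ln (c u) / ln u / u \<le> h / u" by (rule divide_right_mono) (use u in simp)
      then show ?thesis using \<open>0 \<le> k\<close> by linarith
    next
      case False
      have "ln (c u) / ln u / u \<le> (\<bar>ln A\<bar> / w + h/2) / u"
        by (rule divide_right_mono[OF main]) (use u in simp)
      also have "\<dots> = \<bar>ln A\<bar> / (w * u) + h/2 / u" by (simp add: add_divide_distrib)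
      also have "\<dots> \<le> k + h / u"
      proof (rule add_mono)
        show "\<bar>ln A\<bar> / (w * u) \<le> k"
          unfolding k_def using w False r by (intro divide_left_mono mult_mono mult_pos_pos) auto
        show "h/2 / u \<le> h / u" by (rule divide_right_mono) (use u h in auto)
      qed
      finally show ?thesis by simp
    qed
  qed
qed

section \<open>Comparability of \<open>ydot\<close> with \<open>y\<close>\<close>

context quasi_decreasing
begin

text \<open>A zero of \<open>y s\<close> spreads to larger radii by \<open>quasi_antimono\<close>
  and to smaller ones by \<open>scale\<close>.\<close>

lemma zero_or_pos:
  assumes s: "0 \<le> s"
  shows "(\<forall>r>0. y s r = 0) \<or> (\<forall>r>0. 0 < y s r)"
proof (rule disjCI)
  assume "\<not> (\<forall>r>0. 0 < y s r)"
  then obtain r where r: "0 < r" "y s r = 0" using nonneg[OF s] by (metis less_le)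
  show "\<forall>r>0. y s r = 0"
  proof (intro allI impI)
    fix r' :: real assume r': "0 < r'"
    have "y s r' \<le> 0"
    proof (cases "r \<le> r'")
      case True
      then show ?thesis using quasi_antimono[OF s r(1) True] r(2) by simp
    next
      case False
      then show ?thesis using scale[OF s r', of r] r(2) by simp
    qed
    then show "y s r' = 0" using nonneg[OF s r'] by simp
  qed
qed

lemma reciprocal_bounds:
  assumes s: "0 \<le> s" "\<forall>r>0. 0 < y s r" and x: "0 < x" "x \<le> r"
  shows "0 \<le> inverse (y s x)" "inverse (y s x) \<le> 2 / y s r"
proof -
  have p: "0 < y s x" "0 < y s r" using s(2) x by auto
  show "0 \<le> inverse (y s x)" using p by simp
  show "inverse (y s x) \<le> 2 / y s r"
    using quasi_antimono[OF s(1) x] p by (simp add: field_simps)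
qed

lemma reciprocal_integrable:
  assumes s: "0 \<le> s" "\<forall>r>0. 0 < y s r" and r: "0 < r"
  shows "set_integrable lborel {0<..r} (\<lambda>x. inverse (y s x))"
  unfolding set_integrable_def
proof (rule Bochner_Integration.integrable_bound)
  show "integrable lborel (\<lambda>x. indicator {0<..r} x *\<^sub>R (2 / y s r))"
    using set_integrable_const_Ioc unfolding set_integrable_def .
  have "(\<lambda>x. inverse (y s x)) \<in> borel_measurable (restrict_space borel {0<..})"
    by (rule borel_measurable_inverse[OF measurable_radius[OF s(1)]])
  then have "(\<lambda>x. indicator {0<..} x *\<^sub>R inverse (y s x)) \<in> borel_measurable borel"
    by (subst (asm) borel_measurable_restrict_space_iff) auto
  then have "(\<lambda>x. indicator {..r} x *\<^sub>R (indicator {0<..} x *\<^sub>R inverse (y s x))) \<in> borel_measurable borel"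
    by measurable
  also have "(\<lambda>x. indicator {..r} x *\<^sub>R (indicator {0<..} x *\<^sub>R inverse (y s x)))
      = (\<lambda>x. indicator {0<..r} x *\<^sub>R inverse (y s x))"
    by (auto split: split_indicator)
  finally show "(\<lambda>x. indicator {0<..r} x *\<^sub>R inverse (y s x)) \<in> borel_measurable lborel" by simp
  show "AE x in lborel. norm (indicator {0<..r} x *\<^sub>R inverse (y s x))
      \<le> norm (indicator {0<..r} x *\<^sub>R (2 / y s r))"
    using reciprocal_bounds[OF s, of _ r] s(2)[rule_format, OF r]
    by (intro AE_I2) (auto split: split_indicator)
qed

abbreviation recip_primitive :: "real \<Rightarrow> real \<Rightarrow> real" where
  "recip_primitive s r \<equiv> LINT x:{0<..r}|lborel. inverse (y s x)"

text \<open>The upper bound integrates \<open>quasi_antimono\<close>. For the lower bound only the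
  half \<open>{r/2<..r}\<close> is kept: there \<open>scale\<close> gives
  \<open>y s x \<le> 8 * y s r\<close>, and the length \<open>r/2\<close> turns 8 into 16.\<close>

lemma recip_primitive_bounds:
  assumes s: "0 \<le> s" "\<forall>r>0. 0 < y s r" and r: "0 < r"
  shows "recip_primitive s r \<le> 2 * r / y s r" "r / (16 * y s r) \<le> recip_primitive s r"
proof -
  have yr: "0 < y s r" using s(2) r by simp
  note fin = set_integrable_const_Ioc
  have "recip_primitive s r \<le> (LINT x:{0<..r}|lborel. 2 / y s r)"
    by (intro set_integral_mono reciprocal_integrable s r fin) (use reciprocal_bounds[OF s] in auto)
  also have "\<dots> = 2 * r / y s r" using r by (simp add: set_lebesgue_integral_def)
  finally show "recip_primitive s r \<le> 2 * r / y s r" .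
  have "r / (16 * y s r) = (LINT x:{r/2<..r}|lborel. 1 / (8 * y s r))"
    using r by (simp add: set_lebesgue_integral_def)
  also have "\<dots> \<le> recip_primitive s r"
    unfolding set_lebesgue_integral_def
  proof (rule integral_mono)
    show "integrable lborel (\<lambda>x. indicator {r/2<..r} x *\<^sub>R (1 / (8 * y s r)))"
      using fin unfolding set_integrable_def .
    show "integrable lborel (\<lambda>x. indicator {0<..r} x *\<^sub>R inverse (y s x))"
      using reciprocal_integrable[OF s r] unfolding set_integrable_def .
    fix x :: real
    show "indicator {r/2<..r} x *\<^sub>R (1 / (8 * y s r)) \<le> indicator {0<..r} x *\<^sub>R inverse (y s x)"
    proof (cases "x \<in> {r/2<..r}")
      case True
      then have x: "0 < x" "x \<le> r" using r by auto
      have "(r / x)\<^sup>2 \<le> 2\<^sup>2" using True x r by (intro power_mono) (auto simp: field_simps)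
      then have "2 * (r / x)\<^sup>2 * y s r \<le> 8 * y s r" using yr by (intro mult_right_mono) auto
      then have "y s x \<le> 8 * y s r" using scale[OF s(1) x] by linarith
      then have "1 / (8 * y s r) \<le> inverse (y s x)"
        using s(2)[rule_format, OF x(1)] yr by (simp add: field_simps)
      then show ?thesis using True x by simp
    next
      case False
      then show ?thesis using s(2) by (auto split: split_indicator simp: less_imp_le)
    qed
  qed
  finally show "r / (16 * y s r) \<le> recip_primitive s r" .
qed

lemma ydot_eq: "ydot y s r = r / recip_primitive s r"
  by (simp add: ydot_def)

lemma recip_primitive_pos:
  assumes s: "0 \<le> s" "\<forall>r>0. 0 < y s r" and r: "0 < r"
  shows "0 < recip_primitive s r"
  using recip_primitive_bounds(2)[OF assms] s(2)[rule_format, OF r] r by (auto intro: less_le_trans[rotated])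

lemma ydot_bounds:
  assumes s: "0 \<le> s" and r: "0 < r"
  shows "y s r \<le> 2 * ydot y s r" "ydot y s r \<le> 16 * y s r" "0 \<le> ydot y s r"
proof -
  have "y s r \<le> 2 * ydot y s r \<and> ydot y s r \<le> 16 * y s r \<and> 0 \<le> ydot y s r"
  proof (cases "\<forall>r>0. y s r = 0")
    case True
    \<comment> \<open>With \<open>inverse 0 = 0\<close> the primitive is 0, and
      \<open>r / 0 = 0\<close> makes \<open>ydot\<close> vanish together with
      \<open>y\<close>.\<close>
    then have "(LINT x:{0<..r}|lborel. inverse (y s x)) = (LINT x:{0<..r}|lborel. 0)"
      unfolding set_lebesgue_integral_def
      by (intro Bochner_Integration.integral_cong) (auto split: split_indicator)
    then show ?thesis using True r by (simp add: ydot_eq)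
  next
    case False
    then have pos: "\<forall>r>0. 0 < y s r" using zero_or_pos[OF s] by auto
    have F: "0 < recip_primitive s r" by (rule recip_primitive_pos[OF s pos r])
    have "recip_primitive s r * y s r \<le> 2 * r" "r \<le> recip_primitive s r * (16 * y s r)"
      using recip_primitive_bounds[OF s pos r] pos[rule_format, OF r] by (simp_all add: pos_le_divide_eq pos_divide_le_eq)
    then show ?thesis
      using F r by (simp add: ydot_eq pos_le_divide_eq pos_divide_le_eq mult.commute mult.left_commute)
  qed
  then show "y s r \<le> 2 * ydot y s r" "ydot y s r \<le> 16 * y s r" "0 \<le> ydot y s r" by auto
qed

end

section \<open>The three conditions\<close>

lemma mult_le_of_ln_le:
  fixes p1 p2 q1 q2 r h l :: real
  assumes pos: "0 < p2" "0 < q1" "0 < p1" "0 < q2" "0 < r"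
    and le: "ln p2 + ln q1 + h * ln r - l \<le> ln p1 + ln q2"
  shows "p2 * q1 * (r powr h * exp (- l)) \<le> p1 * q2"
proof -
  have "ln (p2 * q1 * (r powr h * exp (- l))) = ln p2 + ln q1 + h * ln r - l"
    using pos by (simp add: ln_mult ln_powr)
  also note le
  also have "ln p1 + ln q2 = ln (p1 * q2)" using pos by (simp add: ln_mult)
  finally show ?thesis using pos by (subst (asm) ln_le_cancel_iff) auto
qed

text \<open>The factors 16 and 2 are those of \<open>recip_primitive_bounds\<close>, and 1024 is
  \<open>16 * 16 * 2 * 2\<close>.\<close>

lemma cross_ratio_le:
  fixes r1 r2 s1 s2 b1 b2 e :: real
  assumes pos: "0 < r1" "0 < r2" "0 < s1" "0 < s2" "0 < b1" "0 < b2"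
    and le: "(r2 / (16 * b2)) * (r1 / (16 * s1)) * e \<le> (2 * r1 / b1) * (2 * r2 / s2)"
  shows "e / 1024 * (s2 / b2) \<le> s1 / b1"
proof -
  define x where "x = b1 * s2 / (4 * r1 * r2)"
  have "0 \<le> x" using pos by (simp add: x_def)
  from mult_left_mono[OF le this] have "e * (b1 * s2 / (1024 * b2 * s1)) \<le> 1"
    using pos by (simp add: x_def field_simps)
  from mult_right_mono[OF this, of "s1 / b1"] show ?thesis
    using pos by (simp add: field_simps)
qed

context quasi_decreasing
begin

text \<open>With \<open>F\<close> the primitive of the reciprocal of \<open>y s\<close>, the
  quotient \<open>y s u / ydot y s u\<close> equals \<open>y s u * F u / u\<close>, so its
  reciprocal divided by \<open>u\<close> is the logarithmic derivative of \<open>F\<close>.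
  Condition (ii) thus compares the logarithmic derivatives for \<open>b\<close> and
  \<open>s\<close>. Their integrals are compared next, and \<open>F\<close> is finally exchanged for
  \<open>y\<close> at both radii.\<close>

lemma condition_ii_imp_slow_growth:
  assumes b: "0 < b" and yb_pos: "\<forall>r>0. 0 < y b r"
    and c: "continuous_slow c" and r0: "r0 \<le> 1/2"
    and ii: "\<And>r s. 0 < r \<Longrightarrow> r < r0 \<Longrightarrow> s \<in> {0<..<b} \<Longrightarrow>
        y s r / ydot y s r - y b r / ydot y b r \<le> ln (c r) / ln r"
    and \<eta>: "0 < \<eta>"
  shows "\<exists>A>0. \<forall>r1 r2 s. 0 < r1 \<and> r1 < r2 \<and> r2 < r0 \<and> 0 < s \<and> s < b \<longrightarrow>
      A * r1 powr \<eta> * (y s r2 / y b r2) \<le> y s r1 / y b r1"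
proof -
  obtain k where k: "0 \<le> k" "\<And>u. 0 < u \<Longrightarrow> u \<le> 1/2 \<Longrightarrow> ln (c u) / ln u / u \<le> (\<eta> / 256) / u + k"
    using slow_log_quotient[OF c, of "\<eta> / 256"] \<eta> by auto
  \<comment> \<open>The exponential comes from the bounded part of the integrated inequality, 1024
    from \<open>cross_ratio_le\<close>. The exponent \<open>\<eta> / 256\<close> above anticipates
    the factor 256 lost when reciprocals of \<open>ps\<close> and \<open>pb\<close> are
    taken.\<close>
  define A where "A = exp (- (256 * k)) / 1024"
  have main: "A * r1 powr \<eta> * (y s r2 / y b r2) \<le> y s r1 / y b r1"
    if r: "0 < r1" "r1 < r2" "r2 < r0" and s: "0 < s" "s < b" for r1 r2 s
  proof (cases "\<forall>r>0. y s r = 0")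
    case True
    then show ?thesis using r by simp
  next
    case False
    have s0: "0 \<le> s" "0 \<le> b" using s b by auto
    have ys_pos: "\<forall>r>0. 0 < y s r" using zero_or_pos[OF s0(1)] False by auto
    note ys = ys_pos[rule_format] and yb = yb_pos[rule_format]
    note Fs = recip_primitive_pos[OF s0(1) ys_pos] and Fb = recip_primitive_pos[OF s0(2) yb_pos]
    have r2: "0 < r2" "r2 \<le> 1/2" using r r0 by auto
    define E where "E = r1 powr \<eta> * exp (- (256 * k))"
    have E: "0 < E" using r by (simp add: E_def)
    have le: "inverse (y b u) / recip_primitive b u
        \<le> inverse (y s u) / recip_primitive s u + \<eta> / u + 256 * k" if u: "r1 \<le> u" "u \<le> r2" for u
    proof -
      have u0: "0 < u" "u < r0" "u \<le> 1/2" using u r r2 by auto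
      define ps where "ps = y s u * recip_primitive s u / u"
      define pb where "pb = y b u * recip_primitive b u / u"
      define \<phi> where "\<phi> = ln (c u) / ln u"
      have "ps - pb \<le> \<phi>"
        using ii[OF u0(1,2), of s] s by (simp add: ps_def pb_def \<phi>_def ydot_eq)
      have "0 < c u" "c u < 1" using continuous_slow_bounds[OF c, of u] u0 by auto
      then have \<phi>: "0 \<le> \<phi>" unfolding \<phi>_def using u0 by (intro divide_nonpos_nonpos) auto
      have ps: "1/16 \<le> ps"
        using recip_primitive_bounds(2)[OF s0(1) ys_pos u0(1)] ys[OF u0(1)] u0
        by (simp add: ps_def pos_divide_le_eq pos_le_divide_eq mult.commute)
      have pb: "1/16 \<le> pb"
        using recip_primitive_bounds(2)[OF s0(2) yb_pos u0(1)] yb[OF u0(1)] u0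
        by (simp add: pb_def pos_divide_le_eq pos_le_divide_eq mult.commute)
      have "1 / pb - 1 / ps \<le> 256 * \<phi>"
      proof -
        have "1 / pb - 1 / ps = (ps - pb) / (pb * ps)" using ps pb by (simp add: field_simps)
        \<comment> \<open>The numerator \<open>ps - pb\<close> may be negative, so it is replaced by
          the nonnegative \<open>\<phi>\<close> before the denominators are bounded below by
          \<open>1/16\<close>.\<close>
        also have "\<dots> \<le> \<phi> / (pb * ps)"
          using \<open>ps - pb \<le> \<phi>\<close> ps pb by (intro divide_right_mono mult_nonneg_nonneg) auto
        also have "\<dots> \<le> \<phi> / (1/16 * (1/16))"
          using \<phi> ps pb by (intro divide_left_mono mult_mono mult_pos_pos) auto
        finally show ?thesis by simp
      qed
      then have "(1 / pb - 1 / ps) / u \<le> 256 * \<phi> / u" using u0 by (intro divide_right_mono) auto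
      also have "\<dots> = 256 * (\<phi> / u)" by simp
      also have "\<dots> \<le> 256 * ((\<eta> / 256) / u + k)"
        unfolding \<phi>_def using k(2)[OF u0(1,3)] by (intro mult_left_mono) auto
      also have "\<dots> = \<eta> / u + 256 * k" by simp
      finally have "1 / pb / u - 1 / ps / u \<le> \<eta> / u + 256 * k" by (simp add: diff_divide_distrib)
      moreover have "1 / pb / u = inverse (y b u) / recip_primitive b u"
        "1 / ps / u = inverse (y s u) / recip_primitive s u"
        using u0 by (simp_all add: pb_def ps_def inverse_eq_divide)
      ultimately show ?thesis by linarith
    qed
    have "ln (recip_primitive b r2) - ln (recip_primitive b r1)
        \<le> ln (recip_primitive s r2) - ln (recip_primitive s r1) + \<eta> * (ln r2 - ln r1) + 256 * k * (r2 - r1)"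
    proof (rule ln_primitive_comparison[where k = "2 / y s r2 + 2 / y b r2"])
      have nn: "0 < 2 / y s r2" "0 < 2 / y b r2" using ys[OF r2(1)] yb[OF r2(1)] by auto
      fix x assume x: "0 < x" "x \<le> r2"
      show "0 \<le> inverse (y b x) \<and> inverse (y b x) \<le> 2 / y s r2 + 2 / y b r2"
        using reciprocal_bounds[OF s0(2) yb_pos x] nn by linarith
      show "0 \<le> inverse (y s x) \<and> inverse (y s x) \<le> 2 / y s r2 + 2 / y b r2"
        using reciprocal_bounds[OF s0(1) ys_pos x] nn by linarith
    next
      show "set_integrable lborel {0<..r2} (\<lambda>x. inverse (y b x))"
        by (rule reciprocal_integrable[OF s0(2) yb_pos r2(1)])
      show "set_integrable lborel {0<..r2} (\<lambda>x. inverse (y s x))"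
        by (rule reciprocal_integrable[OF s0(1) ys_pos r2(1)])
    qed (use r \<eta> Fs[OF r(1)] Fb[OF r(1)] le in auto)
    \<comment> \<open>The terms in \<open>r2\<close> are discarded, so that the remaining loss is a
      power of \<open>r1\<close> alone.\<close>
    also have "\<dots> \<le> ln (recip_primitive s r2) - ln (recip_primitive s r1) - \<eta> * ln r1 + 256 * k"
    proof -
      have "\<eta> * ln r2 \<le> 0" using r2 \<eta> by (intro mult_nonneg_nonpos) auto
      moreover have "256 * k * (r2 - r1) \<le> 256 * k * 1" using r r2 k(1) by (intro mult_left_mono) auto
      ultimately show ?thesis by (simp add: right_diff_distrib)
    qed
    finally have "ln (recip_primitive b r2) + ln (recip_primitive s r1) + \<eta> * ln r1 - 256 * k
        \<le> ln (recip_primitive b r1) + ln (recip_primitive s r2)" by linarith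
    then have "recip_primitive b r2 * recip_primitive s r1 * (r1 powr \<eta> * exp (- (256 * k)))
        \<le> recip_primitive b r1 * recip_primitive s r2"
      by (rule mult_le_of_ln_le[OF Fb[OF r2(1)] Fs[OF r(1)] Fb[OF r(1)] Fs[OF r2(1)] r(1)])
    then have F: "recip_primitive b r2 * recip_primitive s r1 * E
        \<le> recip_primitive b r1 * recip_primitive s r2"
      unfolding E_def .
    note pos = ys[OF r(1)] ys[OF r2(1)] yb[OF r(1)] yb[OF r2(1)]
    note lower = recip_primitive_bounds(2)[OF s0(1) ys_pos r(1)] recip_primitive_bounds(2)[OF s0(2) yb_pos r2(1)]
    note upper = recip_primitive_bounds(1)[OF s0(1) ys_pos r2(1)] recip_primitive_bounds(1)[OF s0(2) yb_pos r(1)]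
    have "(r2 / (16 * y b r2)) * (r1 / (16 * y s r1)) * E
        \<le> recip_primitive b r2 * recip_primitive s r1 * E"
    proof (intro mult_right_mono mult_mono lower)
      show "0 \<le> E" using E by simp
      show "0 \<le> recip_primitive b r2" using Fb[OF r2(1)] by simp
      show "0 \<le> r1 / (16 * y s r1)" using r(1) pos(1) by simp
    qed
    also note F
    also have "recip_primitive b r1 * recip_primitive s r2 \<le> (2 * r1 / y b r1) * (2 * r2 / y s r2)"
    proof (intro mult_mono upper)
      show "0 \<le> recip_primitive s r2" using Fs[OF r2(1)] by simp
      show "0 \<le> 2 * r1 / y b r1" using r(1) pos(3) by simp
    qed
    finally have "E / 1024 * (y s r2 / y b r2) \<le> y s r1 / y b r1"
      by (rule cross_ratio_le[OF r(1) r2(1) pos])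
    then show ?thesis by (simp add: A_def E_def mult.commute)
  qed
  show ?thesis
    by (rule exI[of _ A]) (use main in \<open>auto simp: A_def\<close>)
qed

lemma condition_ii_imp_condition_i:
  assumes b: "0 < b" and ii: "condition_ii y b"
  shows "condition_i y b"
proof (cases "\<forall>r>0. y b r = 0")
  case True
  \<comment> \<open>All quotients by \<open>y b\<close> are 0 here, on both sides of the
    inequality.\<close>
  have half: "continuous_slow (\<lambda>_. 1/2)" by (rule continuous_slow_const) auto
  show ?thesis unfolding condition_i_def
    by (rule exI[of _ "\<lambda>_. 1/2"], rule exI[of _ "\<lambda>_. 1/2"], intro conjI half bexI[of _ 1])
       (use True in auto)
next
  case False
  then have yb_pos: "\<forall>r>0. 0 < y b r" using zero_or_pos[of b] b by auto
  note yb = yb_pos[rule_format]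
  obtain c where c: "continuous_slow c" and ev: "\<forall>\<^sub>F r in at_right 0. \<forall>s\<in>{0<..<b}.
      y s r / ydot y s r - y b r / ydot y b r \<le> ln (c r) / ln r"
    using ii unfolding condition_ii_def by auto
  obtain d where d: "0 < d" "\<And>r s. 0 < r \<Longrightarrow> r < d \<Longrightarrow> s \<in> {0<..<b} \<Longrightarrow>
      y s r / ydot y s r - y b r / ydot y b r \<le> ln (c r) / ln r"
    using ev unfolding eventually_at_right_field by auto
  define r0 where "r0 = min d (1/2)"
  have r0: "0 < r0" "r0 \<le> 1/2" "r0 \<le> 1" "r0 \<le> d" using d(1) by (auto simp: r0_def)
  \<comment> \<open>The ratios that \<open>c1 r1\<close> must undercut, over all admissible
    \<open>s\<close> and \<open>r2\<close>. Times with \<open>y s r2 = 0\<close> are left out, since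
    the inequality is trivial for them and the ratio meaningless.\<close>
  define Z where "Z r1 = {(y s r1 / y b r1) / (y s r2 / y b r2) |s r2.
      r1 < r2 \<and> r2 < r0 \<and> 0 < s \<and> s < b \<and> 0 < y s r2}" for r1
  have low: "\<exists>A>0. \<forall>r a. 0 < r \<longrightarrow> r < r0 \<longrightarrow> a \<in> Z r \<longrightarrow> A * r powr \<eta> \<le> a" if \<eta>: "0 < \<eta>" for \<eta>
  proof -
    have "\<exists>A>0. \<forall>r1 r2 s. 0 < r1 \<and> r1 < r2 \<and> r2 < r0 \<and> 0 < s \<and> s < b \<longrightarrow>
        A * r1 powr \<eta> * (y s r2 / y b r2) \<le> y s r1 / y b r1"
      by (rule condition_ii_imp_slow_growth[OF b yb_pos c r0(2) _ \<eta>]) (use r0(4) d(2) in auto)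
    then obtain A where A: "0 < A" "\<And>r1 r2 s. 0 < r1 \<Longrightarrow> r1 < r2 \<Longrightarrow> r2 < r0 \<Longrightarrow> 0 < s \<Longrightarrow> s < b \<Longrightarrow>
        A * r1 powr \<eta> * (y s r2 / y b r2) \<le> y s r1 / y b r1"
      by blast
    show ?thesis
    proof (intro exI[of _ A] conjI allI impI A(1))
      fix r a assume r: "0 < r" "r < r0" and "a \<in> Z r"
      then obtain s r2 where a: "a = (y s r / y b r) / (y s r2 / y b r2)"
        and *: "r < r2" "r2 < r0" "0 < s" "s < b" "0 < y s r2" unfolding Z_def by auto
      have "0 < y s r2 / y b r2" using * r yb[of r2] by simp
      then show "A * r powr \<eta> \<le> a"
        unfolding a using A(2)[OF r(1) *(1-4)] by (simp only: pos_le_divide_eq)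
    qed
  qed
  obtain c1 where c1: "continuous_slow c1" "\<And>r a. 0 < r \<Longrightarrow> r < r0 \<Longrightarrow> a \<in> Z r \<Longrightarrow> c1 r \<le> a"
    by (rule continuous_slow_minorant[OF r0(3), where Z = Z]) (erule low, rule that)
  \<comment> \<open>The whole loss sits in \<open>c1\<close>; for \<open>c2\<close> a constant
    suffices, taken below 1 since slow functions have values in the open unit interval.\<close>
  have "continuous_slow (\<lambda>_. 1/2)" by (rule continuous_slow_const) auto
  moreover have "y s r2 / y b r2 \<le> inverse (c1 r1) * inverse (1/2) * (y s r1 / y b r1)"
    if r: "0 < r1" "r1 < r2" "r2 < r0" "0 < s" "s < b" for r1 r2 s
  proof (cases "y s r2 = 0")
    case True
    have "0 < c1 r1" using continuous_slow_bounds[OF c1(1)] r r0 by auto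
    then show ?thesis using True nonneg[of s r1] yb[of r1] r by simp
  next
    case False
    then have ys: "0 < y s r2" using nonneg[of s r2] r by auto
    define q where "q = y s r2 / y b r2"
    have q: "0 < q" using ys yb[of r2] r by (simp add: q_def)
    have "0 < c1 r1" using continuous_slow_bounds[OF c1(1)] r r0 by auto
    have "c1 r1 \<le> (y s r1 / y b r1) / q"
      using r ys unfolding q_def by (intro c1(2)) (auto simp: Z_def)
    then have "c1 r1 * q \<le> y s r1 / y b r1" using q by (simp only: pos_le_divide_eq)
    from mult_left_mono[OF this, of "inverse (c1 r1)"]
    have "q \<le> inverse (c1 r1) * (y s r1 / y b r1)"
      using \<open>0 < c1 r1\<close> by (simp only: mult.assoc[symmetric]) simp
    with q have "q \<le> 2 * (inverse (c1 r1) * (y s r1 / y b r1))" by linarith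
    also have "\<dots> = inverse (c1 r1) * inverse (1/2) * (y s r1 / y b r1)" by simp
    finally show ?thesis unfolding q_def .
  qed
  ultimately show ?thesis unfolding condition_i_def
    using c1(1) r0(1,3)
    by (intro exI[of _ c1] exI[of _ "\<lambda>_. 1/2"] conjI bexI[of _ r0] allI impI; (elim conjE)?) auto
qed

section \<open>From condition (i) to the inequality\<close>

text \<open>If the inequality failed, a real \<open>s\<close> strictly between the two values would
  lie in neither defining set. Since \<open>c t * t \<le> 1\<close>, the time \<open>b\<close>
  belongs to the set of \<open>v_over\<close>, so \<open>s < b\<close>, which is the range covered
  by the hypothesis.\<close>

lemma v_over_le_v_under:
  assumes ct: "0 \<le> c t * t" "c t * t \<le> 1" "0 < t" and b: "0 < b"
    and s: "\<And>s. 0 < s \<Longrightarrow> s < b \<Longrightarrow>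
        (\<forall>\<eta>\<in>{\<kappa>-\<epsilon>..<\<kappa>}. y s (t powr (1/\<eta>)) \<ge> c t * t * y b (t powr (1/\<eta>))) \<or>
        (\<forall>\<eta>\<in>{\<kappa><..\<kappa>+\<epsilon>}. y s (t powr (1/\<eta>)) \<le> inverse (c t) * t * y b (t powr (1/\<eta>)))"
  shows "v_over y b \<kappa> \<epsilon> c t \<le> v_under y b \<kappa> \<epsilon> c t"
proof (rule ccontr)
  assume "\<not> ?thesis"
  then have "v_under y b \<kappa> \<epsilon> c t < v_over y b \<kappa> \<epsilon> c t" by (simp only: not_le)
  from dense[OF this] obtain z where z: "v_under y b \<kappa> \<epsilon> c t < z" "z < v_over y b \<kappa> \<epsilon> c t"
    by (elim exE conjE)
  have "z \<noteq> \<top>" using z(2) by auto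
  then obtain s where s_z: "z = ennreal s" "0 \<le> s" by (cases z) auto
  have "0 < z" by (rule le_less_trans[OF zero_le z(1)])
  then have s0: "0 < s" unfolding s_z(1) by simp
  have over: "v_over y b \<kappa> \<epsilon> c t \<le> ennreal u"
    if "0 < u" "\<forall>\<eta>\<in>{\<kappa>-\<epsilon>..<\<kappa>}. y u (t powr (1/\<eta>)) \<ge> c t * t * y b (t powr (1/\<eta>))" for u
    unfolding v_over_def by (rule Inf_lower) (use that in auto)
  have under: "ennreal u \<le> v_under y b \<kappa> \<epsilon> c t"
    if "0 < u" "\<forall>\<eta>\<in>{\<kappa><..\<kappa>+\<epsilon>}. y u (t powr (1/\<eta>)) \<le> inverse (c t) * t * y b (t powr (1/\<eta>))" for u
    unfolding v_under_def by (rule Sup_upper) (use that in auto)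
  have "v_over y b \<kappa> \<epsilon> c t \<le> ennreal b"
    using ct b by (intro over) (auto intro!: mult_left_le_one_le nonneg)
  with z(2) have "ennreal s < ennreal b" unfolding s_z(1) by (rule less_le_trans)
  then have "s < b" using b by (simp add: ennreal_less_iff s_z(2))
  from s[OF s0 this] show False
  proof
    assume "\<forall>\<eta>\<in>{\<kappa>-\<epsilon>..<\<kappa>}. y s (t powr (1/\<eta>)) \<ge> c t * t * y b (t powr (1/\<eta>))"
    from over[OF s0 this] z(2) show False unfolding s_z(1) by simp
  next
    assume "\<forall>\<eta>\<in>{\<kappa><..\<kappa>+\<epsilon>}. y s (t powr (1/\<eta>)) \<le> inverse (c t) * t * y b (t powr (1/\<eta>))"
    from under[OF s0 this] z(1) show False unfolding s_z(1) by simp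
  qed
qed

lemma condition_i_imp_v_inequality:
  assumes b: "0 < b" and i: "condition_i y b" and \<epsilon>: "0 < \<epsilon>" "\<epsilon> < \<kappa>"
  shows "v_inequality y b \<kappa> \<epsilon>"
proof -
  obtain c1 c2 r0 where c1: "continuous_slow c1" and c2: "continuous_slow c2"
    and r0: "0 < r0" "r0 \<le> 1" and growth: "\<And>r1 r2 s. 0 < r1 \<Longrightarrow> r1 < r2 \<Longrightarrow> r2 < r0 \<Longrightarrow> 0 < s \<Longrightarrow> s < b \<Longrightarrow>
        y s r2 / y b r2 \<le> inverse (c1 r1) * inverse (c2 r2) * (y s r1 / y b r1)"
    using i unfolding condition_i_def by auto
  \<comment> \<open>For \<open>t < 1\<close> the radius \<open>t powr (1/\<eta>)\<close> grows with
    \<open>\<eta>\<close>, so the largest exponent \<open>\<kappa> + \<epsilon>\<close> decides when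
    all radii are at most \<open>r0 / 2\<close>.\<close>
  define T where "T = (r0 / 2) powr (\<kappa> + \<epsilon>)"
  have T: "0 < T" "T \<le> 1" unfolding T_def using r0 \<epsilon> by (auto simp: powr_le1)
  have rad: "0 < t powr (1/\<eta>)" "t powr (1/\<eta>) \<le> r0 / 2"
    if t: "0 < t" "t < T" and \<eta>: "\<kappa> - \<epsilon> \<le> \<eta>" "\<eta> \<le> \<kappa> + \<epsilon>" for t \<eta>
  proof -
    show "0 < t powr (1/\<eta>)" using t by simp
    have "t powr (1/\<eta>) \<le> t powr (1/(\<kappa>+\<epsilon>))"
      using t T \<eta> \<epsilon> by (intro powr_mono') (auto simp: divide_left_mono)
    also have "\<dots> \<le> T powr (1/(\<kappa>+\<epsilon>))" using t \<epsilon> by (intro powr_mono2) auto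
    also have "\<dots> = r0 / 2" using r0 \<epsilon> by (simp add: T_def powr_powr)
    finally show "t powr (1/\<eta>) \<le> r0 / 2" .
  qed
  \<comment> \<open>Condition (i) loses slow factors at two radii, while the conclusion allows only
    a function of \<open>t\<close>: it has to lie below all these products at once.\<close>
  define Z where "Z t = {c1 (t powr (1/\<eta>)) * c2 (t powr (1/\<eta>')) |\<eta> \<eta>'.
      \<kappa> - \<epsilon> \<le> \<eta> \<and> \<eta> \<le> \<kappa> + \<epsilon> \<and> \<kappa> - \<epsilon> \<le> \<eta>' \<and> \<eta>' \<le> \<kappa> + \<epsilon>}" for t
  have low: "\<exists>A>0. \<forall>t a. 0 < t \<longrightarrow> t < T \<longrightarrow> a \<in> Z t \<longrightarrow> A * t powr h \<le> a" if h: "0 < h" for h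
  proof -
    \<comment> \<open>Chosen so that \<open>g / \<eta> \<le> h/2\<close> for all
      \<open>\<eta> \<ge> \<kappa> - \<epsilon>\<close>; each of the two slow factors then costs at
      most \<open>t powr (h/2)\<close>.\<close>
    define g where "g = h * (\<kappa> - \<epsilon>) / 2"
    have g: "0 < g" using h \<epsilon> by (simp add: g_def)
    have half: "r0 / 2 < 1" using r0 by simp
    obtain A1 where A1: "0 < A1" "\<And>r. 0 < r \<Longrightarrow> r \<le> r0 / 2 \<Longrightarrow> A1 * r powr g \<le> c1 r"
      using continuous_slow_lower[OF c1 g half] by auto
    obtain A2 where A2: "0 < A2" "\<And>r. 0 < r \<Longrightarrow> r \<le> r0 / 2 \<Longrightarrow> A2 * r powr g \<le> c2 r"
      using continuous_slow_lower[OF c2 g half] by auto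
    have pw: "t powr (h/2) \<le> (t powr (1/\<eta>)) powr g"
      if t: "0 < t" "t < T" and \<eta>: "\<kappa> - \<epsilon> \<le> \<eta>" for t \<eta>
    proof -
      have "g / \<eta> \<le> g / (\<kappa> - \<epsilon>)" using \<eta> \<epsilon> g by (intro divide_left_mono) auto
      also have "\<dots> = h/2" using \<epsilon> by (simp add: g_def field_simps)
      finally have "t powr (h/2) \<le> t powr (g / \<eta>)" using t T by (intro powr_mono') auto
      then show ?thesis by (simp add: powr_powr)
    qed
    show ?thesis
    proof (intro exI[of _ "A1 * A2"] conjI allI impI)
      show "0 < A1 * A2" using A1 A2 by simp
      fix t a assume t: "0 < t" "t < T" and "a \<in> Z t"
      then obtain \<eta> \<eta>' where a: "a = c1 (t powr (1/\<eta>)) * c2 (t powr (1/\<eta>'))"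
        and \<eta>: "\<kappa> - \<epsilon> \<le> \<eta>" "\<eta> \<le> \<kappa> + \<epsilon>" "\<kappa> - \<epsilon> \<le> \<eta>'" "\<eta>' \<le> \<kappa> + \<epsilon>" unfolding Z_def by auto
      have "A1 * t powr (h/2) \<le> A1 * (t powr (1/\<eta>)) powr g"
        using pw[OF t \<eta>(1)] A1 by (intro mult_left_mono) auto
      also have "\<dots> \<le> c1 (t powr (1/\<eta>))" using rad[OF t \<eta>(1,2)] by (rule A1(2))
      finally have 1: "A1 * t powr (h/2) \<le> c1 (t powr (1/\<eta>))" .
      have "A2 * t powr (h/2) \<le> A2 * (t powr (1/\<eta>')) powr g"
        using pw[OF t \<eta>(3)] A2 by (intro mult_left_mono) auto
      also have "\<dots> \<le> c2 (t powr (1/\<eta>'))" using rad[OF t \<eta>(3,4)] by (rule A2(2))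
      finally have 2: "A2 * t powr (h/2) \<le> c2 (t powr (1/\<eta>'))" .
      have "(A1 * t powr (h/2)) * (A2 * t powr (h/2)) \<le> a"
        unfolding a using 1 2 A1 A2 by (intro mult_mono) (auto intro: order_trans[OF _ 1])
      moreover have "t powr (h/2) * t powr (h/2) = t powr h" by (simp add: powr_add[symmetric])
      ultimately show "A1 * A2 * t powr h \<le> a" by (simp add: ac_simps)
    qed
  qed
  obtain c where c: "continuous_slow c" "\<And>t a. 0 < t \<Longrightarrow> t < T \<Longrightarrow> a \<in> Z t \<Longrightarrow> c t \<le> a"
    by (rule continuous_slow_minorant[OF T(2), where Z = Z]) (erule low, rule that)
  have "v_over y b \<kappa> \<epsilon> c t \<le> v_under y b \<kappa> \<epsilon> c t" if t: "0 < t" "t < T" for t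
  proof (rule v_over_le_v_under[OF _ _ t(1) b])
    have t1: "t < 1" using t T by simp
    have ct: "0 < c t" "c t < 1" using continuous_slow_bounds[OF c(1) t(1) t1] .
    show "0 \<le> c t * t" "c t * t \<le> 1" using ct t t1 by (auto intro: mult_le_one)
    \<comment> \<open>The radius at \<open>\<kappa>\<close> separates the two cases: exponents below
      \<open>\<kappa>\<close> give smaller radii and exponents above it larger ones, because
      \<open>t < 1\<close>.\<close>
    define R where "R = t powr (1/\<kappa>)"
    have R: "0 < R" "R \<le> r0 / 2" using rad[OF t, of \<kappa>] \<epsilon> by (auto simp: R_def)
    have c12: "c t \<le> c1 (t powr (1/\<eta>)) * c2 (t powr (1/\<eta>'))"
      if "\<kappa> - \<epsilon> \<le> \<eta>" "\<eta> \<le> \<kappa> + \<epsilon>" "\<kappa> - \<epsilon> \<le> \<eta>'" "\<eta>' \<le> \<kappa> + \<epsilon>" for \<eta> \<eta>'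
      using that by (intro c(2)[OF t]) (auto simp: Z_def)
    fix s assume s: "0 < s" "s < b"
    show "(\<forall>\<eta>\<in>{\<kappa>-\<epsilon>..<\<kappa>}. y s (t powr (1/\<eta>)) \<ge> c t * t * y b (t powr (1/\<eta>))) \<or>
        (\<forall>\<eta>\<in>{\<kappa><..\<kappa>+\<epsilon>}. y s (t powr (1/\<eta>)) \<le> inverse (c t) * t * y b (t powr (1/\<eta>)))"
    proof (cases "\<forall>r>0. y b r = 0")
      case True
      then show ?thesis using t s by (auto intro!: disjI1 nonneg)
    next
      case False
      then have yb: "\<And>r. 0 < r \<Longrightarrow> 0 < y b r" using zero_or_pos[of b] b by auto
      have comparison: "c t * (y s r2 / y b r2) \<le> y s r1 / y b r1"
        if "r1 = t powr (1/\<eta>)" "r2 = t powr (1/\<eta>')" "r1 < r2"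
          "\<kappa> - \<epsilon> \<le> \<eta>" "\<eta> \<le> \<kappa> + \<epsilon>" "\<kappa> - \<epsilon> \<le> \<eta>'" "\<eta>' \<le> \<kappa> + \<epsilon>" for r1 r2 \<eta> \<eta>'
      proof -
        have r: "0 < r1" "r2 < r0" "r1 < 1" "r2 < 1" "0 < r2"
          using rad[OF t, of \<eta>] rad[OF t, of \<eta>'] that r0 by auto
        have pos: "0 < c1 r1" "0 < c2 r2"
          using continuous_slow_bounds(1)[OF c1, of r1] continuous_slow_bounds(1)[OF c2, of r2] r by auto
        have "c t * (y s r2 / y b r2) \<le> (c1 r1 * c2 r2) * (y s r2 / y b r2)"
          using c12[of \<eta> \<eta>'] that nonneg[of s r2] yb[of r2] s r by (intro mult_right_mono) auto
        also have "\<dots> \<le> (c1 r1 * c2 r2) * (inverse (c1 r1) * inverse (c2 r2) * (y s r1 / y b r1))"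
          using growth[OF r(1) that(3) r(2) s] pos by (intro mult_left_mono) auto
        also have "\<dots> = y s r1 / y b r1" using pos by (simp add: field_simps)
        finally show ?thesis .
      qed
      show ?thesis
      proof (cases "t * y b R \<le> y s R")
        case True
        have "c t * t * y b (t powr (1/\<eta>)) \<le> y s (t powr (1/\<eta>))" if \<eta>: "\<eta> \<in> {\<kappa>-\<epsilon>..<\<kappa>}" for \<eta>
        proof -
          have "t powr (1/\<eta>) < R" unfolding R_def
            using \<eta> \<epsilon> t t1 by (intro powr_less_mono') (auto simp: divide_strict_left_mono)
          then have *: "c t * (y s R / y b R) \<le> y s (t powr (1/\<eta>)) / y b (t powr (1/\<eta>))"
            using \<eta> \<epsilon> by (intro comparison[OF refl R_def]) auto
          have "t \<le> y s R / y b R" using True yb[OF R(1)] by (simp add: pos_le_divide_eq)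
          then have "c t * t \<le> c t * (y s R / y b R)" using ct by (intro mult_left_mono) auto
          with * have "c t * t \<le> y s (t powr (1/\<eta>)) / y b (t powr (1/\<eta>))" by linarith
          then show ?thesis using yb[of "t powr (1/\<eta>)"] t by (simp add: pos_le_divide_eq)
        qed
        then show ?thesis by blast
      next
        case False
        have "y s (t powr (1/\<eta>)) \<le> inverse (c t) * t * y b (t powr (1/\<eta>))" if \<eta>: "\<eta> \<in> {\<kappa><..\<kappa>+\<epsilon>}" for \<eta>
        proof -
          have "R < t powr (1/\<eta>)" unfolding R_def
            using \<eta> \<epsilon> t t1 by (intro powr_less_mono') (auto simp: divide_strict_left_mono)
          then have *: "c t * (y s (t powr (1/\<eta>)) / y b (t powr (1/\<eta>))) \<le> y s R / y b R"
            using \<eta> \<epsilon> by (intro comparison[OF R_def refl]) auto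
          have "y s R / y b R \<le> t" using False yb[OF R(1)] by (simp add: pos_divide_le_eq)
          with * have "c t * (y s (t powr (1/\<eta>)) / y b (t powr (1/\<eta>))) \<le> t" by linarith
          then have "y s (t powr (1/\<eta>)) / y b (t powr (1/\<eta>)) \<le> inverse (c t) * t"
            using ct by (simp add: field_simps)
          then show ?thesis using yb[of "t powr (1/\<eta>)"] t by (simp add: pos_divide_le_eq)
        qed
        then show ?thesis by blast
      qed
    qed
  qed
  then show ?thesis unfolding v_inequality_def eventually_at_right_field
    using c(1) T(1) by blast
qed

section \<open>From condition (iii) to the inequality\<close>

text \<open>The infimum is approached from the left by times outside the level set, and from the
  right, or at \<open>s\<close> itself, by times in it. Limits are taken for \<open>y\<close>, which
  is continuous in time; passing to \<open>y\<close> and back costs the factors 2 and 16 of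
  \<open>ydot_bounds\<close>, together 32. The bound on \<open>P\<close> puts \<open>b\<close> into
  the level set, which is therefore nonempty.\<close>

lemma ydot_level_time_bounds:
  assumes r: "0 < r" and P: "0 < P" "P \<le> ydot y b r" and b: "0 < b"
    and s: "s = Inf {s. 0 < s \<and> P \<le> ydot y s r}" "0 < s"
  shows "P / 32 \<le> ydot y s r" "ydot y s r \<le> 32 * P"
proof -
  let ?S = "{s. 0 < s \<and> P \<le> ydot y s r}"
  have cont: "((\<lambda>u. y u r) \<longlongrightarrow> y s r) (at s)"
  proof -
    have "continuous_on {0<..} (\<lambda>u. y u r)"
      by (rule continuous_on_subset[OF continuous_time[OF r]]) auto
    then have "continuous (at s) (\<lambda>u. y u r)"
      using s(2) by (subst (asm) continuous_on_eq_continuous_at) auto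
    then show ?thesis by (simp add: continuous_at)
  qed
  have bdd: "bdd_below ?S" by (rule bdd_belowI[of _ 0]) auto
  have ne: "?S \<noteq> {}" using b P by auto
  have below: "y u r \<le> 2 * P" if "0 < u" "u < s" for u
  proof -
    have "u \<notin> ?S" using cInf_lower[OF _ bdd, of u] that s(1) by auto
    then have "ydot y u r \<le> P" using that by auto
    then show ?thesis using ydot_bounds(1)[of u r] that r by simp
  qed
  have "((\<lambda>u. y u r) \<longlongrightarrow> y s r) (at_left s)"
    by (rule tendsto_within_subset[OF cont]) auto
  moreover have "\<forall>\<^sub>F u in at_left s. y u r \<le> 2 * P"
    unfolding eventually_at_left_field by (rule exI[of _ 0]) (use s(2) below in auto)
  ultimately have "y s r \<le> 2 * P" by (rule tendsto_upperbound) auto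
  then show "ydot y s r \<le> 32 * P" using ydot_bounds(2)[of s r] s(2) r by simp
  have "P / 16 \<le> y s r"
  proof (rule ccontr)
    assume neg: "\<not> P / 16 \<le> y s r"
    then have "\<forall>\<^sub>F u in at s. y u r < P / 16" by (intro order_tendstoD(2)[OF cont]) auto
    then obtain d where d: "0 < d" "\<And>u. u \<noteq> s \<Longrightarrow> dist u s < d \<Longrightarrow> y u r < P / 16"
      unfolding eventually_at by auto
    have "Inf ?S < s + d" using d(1) s(1) by simp
    then obtain u where u: "u \<in> ?S" "u < s + d" using cInf_less_iff[OF ne bdd] by blast
    have "s \<le> u" using cInf_lower[OF u(1) bdd] s(1) by simp
    then have "y u r < P / 16" using d(2)[of u] neg u(2) by (cases "u = s") (auto simp: dist_real_def)
    moreover have "P \<le> 16 * y u r" using u(1) ydot_bounds(2)[of u r] r by auto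
    ultimately show False by simp
  qed
  then show "P / 32 \<le> ydot y s r" using ydot_bounds(1)[of s r] s(2) r by simp
qed

text \<open>Uniform continuity controls \<open>f_over\<close> and \<open>f_under\<close> only on a
  neighbourhood of fixed size \<open>d\<close> around \<open>(0, \<kappa>)\<close>, and
  \<open>\<epsilon>\<close> must stay below \<open>d\<close>; hence the eventual quantifier.\<close>

lemma condition_iii_imp_v_inequality:
  assumes b: "0 < b" and iii: "condition_iii y b \<kappa>"
  shows "\<forall>\<^sub>F \<epsilon> in at_right 0. v_inequality y b \<kappa> \<epsilon>"
proof (cases "\<forall>r>0. y b r = 0")
  case True
  have half: "continuous_slow (\<lambda>_. 1/2)" by (rule continuous_slow_const) auto
  have "v_inequality y b \<kappa> \<epsilon>" for \<epsilon>
    unfolding v_inequality_def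
  proof (rule exI[of _ "\<lambda>_. 1/2"], rule conjI[OF half])
    show "\<forall>\<^sub>F t in at_right 0. v_over y b \<kappa> \<epsilon> (\<lambda>_. 1/2) t \<le> v_under y b \<kappa> \<epsilon> (\<lambda>_. 1/2) t"
      unfolding eventually_at_right_field
    proof (intro exI[of _ 1] conjI allI impI)
      fix t :: real assume t: "0 < t" "t < 1"
      show "v_over y b \<kappa> \<epsilon> (\<lambda>_. 1/2) t \<le> v_under y b \<kappa> \<epsilon> (\<lambda>_. 1/2) t"
        by (rule v_over_le_v_under) (use t b True in \<open>auto intro: nonneg\<close>)
    qed simp
  qed
  then show ?thesis by simp
next
  case False
  then have yb: "\<And>r. 0 < r \<Longrightarrow> 0 < y b r" using zero_or_pos[of b] b by auto
  obtain c v \<sigma> T \<epsilon>0 where body: "continuous_slow c \<and> 0 < T \<and> T < 1 \<and> 0 < \<epsilon>0 \<and> \<epsilon>0 < \<kappa> \<and>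
        continuous_on {0<..T} v \<and> (\<forall>t\<in>{0<..T}. 0 < v t) \<and>
        (\<forall>n. \<sigma> n \<in> {0<..T}) \<and> decseq \<sigma> \<and> \<sigma> \<longlonglongrightarrow> 0 \<and>
        (\<forall>n. v (\<sigma> n) = Inf {s. 0 < s \<and>
           ydot y s (\<sigma> n powr (1/\<kappa>)) \<ge> c (\<sigma> n) * \<sigma> n * ydot y b (\<sigma> n powr (1/\<kappa>))}) \<and>
        uniformly_continuous_on ({0<..T} \<times> {\<kappa>-\<epsilon>0..\<kappa>}) (\<lambda>(t, \<eta>). f_over y b c v t \<eta>) \<and>
        uniformly_continuous_on ({0<..T} \<times> {\<kappa>..\<kappa>+\<epsilon>0}) (\<lambda>(t, \<eta>). f_under y b c v t \<eta>)"
    using iii unfolding condition_iii_def by (elim exE) (rule that)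
  from body have c: "continuous_slow c" by (elim conjE)
  from body have T: "0 < T" "T < 1" and \<epsilon>0: "0 < \<epsilon>0" "\<epsilon>0 < \<kappa>" by - (elim conjE, assumption)+
  from body have v: "\<And>t. t \<in> {0<..T} \<Longrightarrow> 0 < v t" by (elim conjE) (rule bspec)
  from body have \<sigma>: "\<And>n. \<sigma> n \<in> {0<..T}" by (elim conjE) (erule spec)
  from body have \<sigma>_lim: "\<sigma> \<longlonglongrightarrow> 0" by (elim conjE)
  from body have v\<sigma>: "\<And>n. v (\<sigma> n) = Inf {s. 0 < s \<and>
      ydot y s (\<sigma> n powr (1/\<kappa>)) \<ge> c (\<sigma> n) * \<sigma> n * ydot y b (\<sigma> n powr (1/\<kappa>))}"
    by (elim conjE) (erule spec)
  from body have f_over: "uniformly_continuous_on ({0<..T} \<times> {\<kappa>-\<epsilon>0..\<kappa>}) (\<lambda>(t, \<eta>). f_over y b c v t \<eta>)"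
    by (elim conjE)
  from body have f_under: "uniformly_continuous_on ({0<..T} \<times> {\<kappa>..\<kappa>+\<epsilon>0}) (\<lambda>(t, \<eta>). f_under y b c v t \<eta>)"
    by (elim conjE)
  have level: "0 < c t * t * ydot y b (t powr (1/\<eta>))" "c t * t * ydot y b (t powr (1/\<eta>)) \<le> ydot y b (t powr (1/\<eta>))"
    if t: "t \<in> {0<..T}" for t \<eta>
  proof -
    have ct: "0 < c t" "c t < 1" using continuous_slow_bounds[OF c, of t] t T by auto
    have "0 < ydot y b (t powr (1/\<eta>))"
      using ydot_bounds(1)[of b "t powr (1/\<eta>)"] yb[of "t powr (1/\<eta>)"] b t by simp
    moreover have "c t * t \<le> 1" using ct t T by (intro mult_le_one) auto
    ultimately show "0 < c t * t * ydot y b (t powr (1/\<eta>))"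
      "c t * t * ydot y b (t powr (1/\<eta>)) \<le> ydot y b (t powr (1/\<eta>))"
      using ct t by (auto simp: mult_le_cancel_right1)
  qed
  have at_\<sigma>: "1/32 \<le> f_over y b c v (\<sigma> n) \<kappa>" "1/32 \<le> f_under y b c v (\<sigma> n) \<kappa>" for n
  proof -
    define P where "P = c (\<sigma> n) * \<sigma> n * ydot y b (\<sigma> n powr (1/\<kappa>))"
    have r: "0 < \<sigma> n powr (1/\<kappa>)" using \<sigma>[of n] by simp
    have P: "0 < P" using level(1)[OF \<sigma>] by (simp add: P_def)
    have bounds: "P / 32 \<le> ydot y (v (\<sigma> n)) (\<sigma> n powr (1/\<kappa>))" "ydot y (v (\<sigma> n)) (\<sigma> n powr (1/\<kappa>)) \<le> 32 * P"
      using ydot_level_time_bounds[OF r P _ b v\<sigma>[of n, folded P_def] v[OF \<sigma>]]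
        level(2)[OF \<sigma>, of n \<kappa>, folded P_def] by blast+
    show "1/32 \<le> f_over y b c v (\<sigma> n) \<kappa>"
      using bounds(1) P unfolding f_over_def P_def[symmetric] by (simp add: pos_le_divide_eq)
    show "1/32 \<le> f_under y b c v (\<sigma> n) \<kappa>"
      using bounds P unfolding f_under_def P_def[symmetric] by (simp add: pos_le_divide_eq)
  qed
  \<comment> \<open>The tolerance \<open>1/64\<close> is half of the lower bound \<open>1/32\<close>
    at the points \<open>(\<sigma> n, \<kappa>)\<close>.\<close>
  obtain d1 where d1: "0 < d1" "\<And>p q. p \<in> {0<..T} \<times> {\<kappa>-\<epsilon>0..\<kappa>} \<Longrightarrow> q \<in> {0<..T} \<times> {\<kappa>-\<epsilon>0..\<kappa>} \<Longrightarrow>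
      dist q p < d1 \<Longrightarrow> dist (case q of (t, \<eta>) \<Rightarrow> f_over y b c v t \<eta>) (case p of (t, \<eta>) \<Rightarrow> f_over y b c v t \<eta>) < 1/64"
    using f_over unfolding uniformly_continuous_on_def by (metis zero_less_divide_1_iff zero_less_numeral)
  obtain d2 where d2: "0 < d2" "\<And>p q. p \<in> {0<..T} \<times> {\<kappa>..\<kappa>+\<epsilon>0} \<Longrightarrow> q \<in> {0<..T} \<times> {\<kappa>..\<kappa>+\<epsilon>0} \<Longrightarrow>
      dist q p < d2 \<Longrightarrow> dist (case q of (t, \<eta>) \<Rightarrow> f_under y b c v t \<eta>) (case p of (t, \<eta>) \<Rightarrow> f_under y b c v t \<eta>) < 1/64"
    using f_under unfolding uniformly_continuous_on_def by (metis zero_less_divide_1_iff zero_less_numeral)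
  define d where "d = min (min d1 d2 / 2) (min T \<epsilon>0)"
  have d: "0 < d" "d \<le> T" "d \<le> \<epsilon>0" "2 * d \<le> d1" "2 * d \<le> d2"
    using d1(1) d2(1) T \<epsilon>0 by (auto simp: d_def)
  \<comment> \<open>The point \<open>(0, \<kappa>)\<close> is outside the domain. Since
    \<open>\<sigma>\<close> tends to 0, some \<open>\<sigma> n\<close> lies in the same short
    interval as \<open>t\<close>; each coordinate contributes less than \<open>d\<close> to the
    distance.\<close>
  have near: "\<exists>n. dist (t, \<eta>) (\<sigma> n, \<kappa>) < 2 * d" if "0 < t" "t < d" "\<bar>\<eta> - \<kappa>\<bar> < d" for t \<eta>
  proof -
    have "\<forall>\<^sub>F n in sequentially. \<sigma> n < d" by (rule order_tendstoD(2)[OF \<sigma>_lim d(1)])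
    then obtain n where n: "\<sigma> n < d" using eventually_happens trivial_limit_sequentially by blast
    have "dist (t, \<eta>) (\<sigma> n, \<kappa>) \<le> \<bar>t - \<sigma> n\<bar> + \<bar>\<eta> - \<kappa>\<bar>"
      unfolding dist_Pair_Pair dist_real_def using sqrt_sum_squares_le_sum_abs[of "t - \<sigma> n" "\<eta> - \<kappa>"] by simp
    also have "\<dots> < d + d" using n \<sigma>[of n] that by (intro add_strict_mono) auto
    finally show ?thesis by auto
  qed
  have over: "1/64 \<le> f_over y b c v t \<eta>" if "0 < t" "t < d" "\<kappa> - d < \<eta>" "\<eta> \<le> \<kappa>" for t \<eta>
  proof -
    have "\<bar>\<eta> - \<kappa>\<bar> < d" using that by auto
    from near[OF that(1,2) this] obtain n where n: "dist (t, \<eta>) (\<sigma> n, \<kappa>) < 2 * d" ..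
    have "dist (f_over y b c v t \<eta>) (f_over y b c v (\<sigma> n) \<kappa>) < 1/64"
      using d1(2)[of "(\<sigma> n, \<kappa>)" "(t, \<eta>)"] n \<sigma>[of n] that d \<epsilon>0 by auto
    then show ?thesis using at_\<sigma>(1)[of n] unfolding dist_real_def by linarith
  qed
  have under: "1/64 \<le> f_under y b c v t \<eta>" if "0 < t" "t < d" "\<kappa> \<le> \<eta>" "\<eta> < \<kappa> + d" for t \<eta>
  proof -
    have "\<bar>\<eta> - \<kappa>\<bar> < d" using that by auto
    from near[OF that(1,2) this] obtain n where n: "dist (t, \<eta>) (\<sigma> n, \<kappa>) < 2 * d" ..
    have "dist (f_under y b c v t \<eta>) (f_under y b c v (\<sigma> n) \<kappa>) < 1/64"
      using d2(2)[of "(\<sigma> n, \<kappa>)" "(t, \<eta>)"] n \<sigma>[of n] that d \<epsilon>0 by auto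
    then show ?thesis using at_\<sigma>(2)[of n] unfolding dist_real_def by linarith
  qed
  \<comment> \<open>2048 is \<open>64 * 2 * 16\<close>: the bound \<open>1/64\<close> for
    \<open>f_over\<close> and \<open>f_under\<close>, and the two constants for exchanging
    \<open>y\<close> and \<open>ydot\<close> at the times \<open>b\<close> and
    \<open>v t\<close>.\<close>
  have slow: "continuous_slow (\<lambda>t. 1/2048 * c t)" by (rule continuous_slow_cmult[OF c]) auto
  have "v_over y b \<kappa> \<epsilon> (\<lambda>t. 1/2048 * c t) t \<le> v_under y b \<kappa> \<epsilon> (\<lambda>t. 1/2048 * c t) t"
    if \<epsilon>: "\<epsilon> < d" and t: "0 < t" "t < d" for \<epsilon> t
  proof -
    have tT: "t \<in> {0<..T}" using t d by auto
    have ct: "0 < c t" "c t < 1" using continuous_slow_bounds[OF c, of t] tT T by auto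
    have vt: "0 < v t" by (rule v[OF tT])
    have "v_over y b \<kappa> \<epsilon> (\<lambda>t. 1/2048 * c t) t \<le> ennreal (v t)"
      unfolding v_over_def
    proof (rule Inf_lower, rule imageI, intro CollectI conjI ballI vt)
      fix \<eta> assume \<eta>: "\<eta> \<in> {\<kappa>-\<epsilon>..<\<kappa>}"
      define r where "r = t powr (1/\<eta>)"
      have r: "0 < r" using t by (simp add: r_def)
      have "1/64 \<le> ydot y (v t) r / (c t * t * ydot y b r)"
        using over[OF t, of \<eta>] \<eta> \<epsilon> unfolding f_over_def r_def by auto
      then have "c t * t * ydot y b r \<le> 64 * ydot y (v t) r"
        using level(1)[OF tT, of \<eta>] by (simp add: r_def pos_le_divide_eq)
      moreover have "(c t * t) * y b r \<le> (c t * t) * (2 * ydot y b r)"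
        using ct t b r by (intro mult_left_mono ydot_bounds) auto
      moreover have "ydot y (v t) r \<le> 16 * y (v t) r" using vt r by (intro ydot_bounds) auto
      ultimately show "1/2048 * c t * t * y b (t powr (1/\<eta>)) \<le> y (v t) (t powr (1/\<eta>))"
        unfolding r_def[symmetric] by simp
    qed
    also have "ennreal (v t) \<le> v_under y b \<kappa> \<epsilon> (\<lambda>t. 1/2048 * c t) t"
      unfolding v_under_def
    proof (rule Sup_upper, rule imageI, intro CollectI conjI ballI vt)
      fix \<eta> assume \<eta>: "\<eta> \<in> {\<kappa><..\<kappa>+\<epsilon>}"
      define r where "r = t powr (1/\<eta>)"
      have r: "0 < r" using t by (simp add: r_def)
      have pos: "0 \<le> y b r" using b r by (intro nonneg) auto
      have "ydot y (v t) r \<le> 64 * (c t * t * ydot y b r)"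
      proof (cases "ydot y (v t) r = 0")
        case True
        then show ?thesis using level(1)[OF tT, of \<eta>] by (simp add: r_def)
      next
        case False
        then have "0 < ydot y (v t) r" using ydot_bounds(3)[of "v t" r] vt r by simp
        moreover have "1/64 \<le> c t * t * ydot y b r / ydot y (v t) r"
          using under[OF t, of \<eta>] \<eta> \<epsilon> False unfolding f_under_def r_def by auto
        ultimately show ?thesis by (simp add: pos_le_divide_eq)
      qed
      moreover have "(c t * t) * ydot y b r \<le> (c t * t) * (16 * y b r)"
        using ct t b r by (intro mult_left_mono ydot_bounds) auto
      moreover have "y (v t) r \<le> 2 * ydot y (v t) r" using vt r by (intro ydot_bounds) auto
      ultimately have "y (v t) r \<le> 2048 * (c t * (t * y b r))" by (simp add: mult.assoc)
      \<comment> \<open>The bound obtained has the factor \<open>c t\<close>; as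
        \<open>c t < 1\<close>, it is stronger than the one with \<open>inverse (c t)\<close> in
        \<open>v_under\<close>.\<close>
      also have "\<dots> \<le> 2048 * (inverse (c t) * (t * y b r))"
      proof -
        have "c t \<le> inverse (c t)" using ct by (metis inverse_le_1_iff less_imp_le order_trans one_le_inverse)
        then show ?thesis using t pos by (intro mult_left_mono mult_right_mono) auto
      qed
      also have "\<dots> = inverse (1/2048 * c t) * t * y b r" using ct by (simp add: field_simps)
      finally show "y (v t) (t powr (1/\<eta>)) \<le> inverse (1/2048 * c t) * t * y b (t powr (1/\<eta>))"
        unfolding r_def[symmetric] .
    qed
    finally show ?thesis .
  qed
  then have "v_inequality y b \<kappa> \<epsilon>" if "\<epsilon> < d" for \<epsilon>
    unfolding v_inequality_def eventually_at_right_field using that slow d(1) by blast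
  then show ?thesis unfolding eventually_at_right_field using d(1) by blast
qed

end

theorem proposition4p2:
  fixes M :: "'a measure"
    and X :: "real \<Rightarrow> 'a \<Rightarrow> real ^ 'd"
    and B C :: "'d \<Rightarrow> real \<Rightarrow> real"
    and \<nu> :: "'d \<Rightarrow> real \<Rightarrow> real measure"
    and b :: real
  defines "y \<equiv> y_fun B C \<nu>"
  defines "\<delta> \<equiv> delta_index y b" and "\<beta> \<equiv> beta_index y b"
  assumes additive: "\<And>i. additive_process M (\<lambda>t \<omega>. X t \<omega> $ i)"
    and characteristics: "\<And>i. has_characteristics M (\<lambda>t \<omega>. X t \<omega> $ i) (B i) (C i) (\<nu> i)"
    and b: "0 < b"
  shows
    "(condition_i y b \<longrightarrow>
        (\<forall>\<epsilon>. 0 < \<epsilon> \<and> \<epsilon> < \<delta> \<longrightarrow> v_inequality y b \<delta> \<epsilon>) \<and>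
        (\<forall>\<epsilon>. 0 < \<epsilon> \<and> \<epsilon> < \<beta> \<longrightarrow> v_inequality y b \<beta> \<epsilon>)) \<and>
     (condition_ii y b \<longrightarrow>
        (\<forall>\<epsilon>. 0 < \<epsilon> \<and> \<epsilon> < \<delta> \<longrightarrow> v_inequality y b \<delta> \<epsilon>) \<and>
        (\<forall>\<epsilon>. 0 < \<epsilon> \<and> \<epsilon> < \<beta> \<longrightarrow> v_inequality y b \<beta> \<epsilon>)) \<and>
     (condition_iii y b \<delta> \<longrightarrow> (\<forall>\<^sub>F \<epsilon> in at_right 0. v_inequality y b \<delta> \<epsilon>)) \<and>
     (condition_iii y b \<beta> \<longrightarrow> (\<forall>\<^sub>F \<epsilon> in at_right 0. v_inequality y b \<beta> \<epsilon>))"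
proof -
  interpret quasi_decreasing y
    unfolding y_def by (intro quasi_decreasing_y_fun has_characteristics_imp_characteristics[OF characteristics])
  show ?thesis
    using condition_i_imp_v_inequality[OF b] condition_ii_imp_condition_i[OF b]
      condition_iii_imp_v_inequality[OF b] by blast
qed

end
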